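(* For every $n\geq 1$ and $k\geq 1$, the singular foliation $\mathcal{F}_k=\mathcal{I}_0^k\,\mathfrak{X}_{\mathbb{R}^n}$ is the anchor image of the finite-rank Lie algebroid $$A=\mathbb{R}^n\times\bigl(S^k(\mathbb{R}^n)^*\otimes\mathbb{R}^n\bigr)\longrightarrow\mathbb{R}^n,$$ with anchor $\rho(a)_x=a_x(x,\ldots,x)$ and bracket $[a,b]_A=a\triangleright b-b\triangleright a$, whose rank is $n\binom{n+k-1}{k}$. That is, $(A,\rho,[\cdot,\cdot]_A)$ is a Lie algebroid of this rank and $\rho(\Gamma(U,A))=\mathcal{F}_k(U)$ for every open subset $U\subseteq\mathbb{R}^n$.
   Context: Setting. Put $V=\mathbb{R}^n$. $C^\infty_V$ is the sheaf of smooth functions on $V$, $\mathfrak{X}_V$ the sheaf of smooth vector fields on $V$, and $\mathcal{I}_0\subset C^\infty_V$ the ideal sheaf of the origin (functions vanishing at $0$; thus $\mathcal{I}_0(U)=C^\infty(U)$ if $0\notin U$). $\mathcal{F}_k=\mathcal{I}_0^k\mathfrak{X}_V$ is the subsheaf of $\mathfrak{X}_V$ whose sections are the vector fields that are locally finite sums of terms $f_1\cdots f_k X$ with $f_i$ sections of $\mathcal{I}_0$ and $X$ a section of $\mathfrak{X}_V$. $V$ carries its canonical flat torsion-free connection $D$; $D$ also denotes the induced flat connections on all trivial tensor bundles over $V$ (componentwise directional derivative). Vector fields on $V$ are identified with smooth maps $V\to V$. The fiber $S^kV^*\otimes V$ is identified with the space of symmetric $k$-linear maps $V^k\to V$, so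 a section $a$ of $A$ is a smooth family $x\mapsto a_x$ of symmetric $k$-linear maps $a_x\colon V^k\to V$. $\Gamma(U,A)$ denotes smooth sections over $U$, $\Gamma(A)=\Gamma(V,A)$. For $a\in\Gamma(A)$, $\Lambda_a\in C^\infty(V,\operatorname{End}(V))$ is the endomorphism field $(\Lambda_a)_x(u)=a_x(x,\ldots,x,u)$ (with $k-1$ entries $x$). The product $\triangleright$ on $\Gamma(A)$ is $$(a\triangleright b)(u_1,\ldots,u_k)=(D_{\rho(a)}b)(u_1,\ldots,u_k)+\sum_{i=1}^k b(u_1,\ldots,u_{i-1},\Lambda_a u_i,u_{i+1},\ldots,u_k).$$ *)

theory Defs
  imports "HOL-Analysis.Analysis" "HOL-Library.Function_Algebras" "HOL-Combinatorics.Permutations"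
begin

section \<open>Function spaces as real vector spaces\<close>

instantiation "fun" :: (type, real_vector) real_vector
begin

definition "scaleR c f = (\<lambda>x. c *\<^sub>R f x)"

instance
  by standard (simp_all add: scaleR_fun_def plus_fun_def fun_eq_iff algebra_simps)

end

section \<open>Smooth maps\<close>

text \<open>\<open>differentiable_upto r U f\<close> is the class \<open>C\<^sup>r\<close>. It is meant for open \<open>U\<close> only; there it
  depends only on the values of \<open>f\<close> on \<open>U\<close>.\<close>

primrec differentiable_upto ::
  "nat \<Rightarrow> 'a::euclidean_space set \<Rightarrow> ('a \<Rightarrow> 'b::real_normed_vector) \<Rightarrow> bool" where
  "differentiable_upto 0 U f \<longleftrightarrow> continuous_on U f"
| "differentiable_upto (Suc r) U f \<longleftrightarrow>
     (\<forall>x\<in>U. f differentiable (at x)) \<and>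
     (\<forall>v. differentiable_upto r U (\<lambda>x. frechet_derivative f (at x) v))"

definition smooth_on :: "'a::euclidean_space set \<Rightarrow> ('a \<Rightarrow> 'b::real_normed_vector) \<Rightarrow> bool" where
  "smooth_on U f \<longleftrightarrow> (\<forall>r. differentiable_upto r U f)"

text \<open>Maps defined on \<open>U\<close> are elements of \<open>extensional U\<close>, so that they are determined by their
  values on \<open>U\<close>. With real values this is \<open>C\<^sup>\<infinity>(U)\<close>; with values in the space itself these are the
  vector fields on \<open>U\<close>.\<close>

definition smooth_maps :: "'a::euclidean_space set \<Rightarrow> ('a \<Rightarrow> 'b::real_normed_vector) set" where
  "smooth_maps U = {f \<in> extensional U. smooth_on U f}"

abbreviation smooth_funs :: "'a::euclidean_space set \<Rightarrow> ('a \<Rightarrow> real) set" where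
  "smooth_funs \<equiv> smooth_maps"

abbreviation vector_fields :: "'v::euclidean_space set \<Rightarrow> ('v \<Rightarrow> 'v) set" where
  "vector_fields \<equiv> smooth_maps"

text \<open>The derivative \<open>D\<^sub>X f\<close> of \<open>f\<close> along the vector field \<open>X\<close> (the flat connection).\<close>

definition deriv_along ::
  "('v \<Rightarrow> 'v) \<Rightarrow> ('v::euclidean_space \<Rightarrow> 'b::real_normed_vector) \<Rightarrow> 'v \<Rightarrow> 'b" where
  "deriv_along X f = (\<lambda>x. frechet_derivative f (at x) (X x))"

definition vf_bracket :: "('v \<Rightarrow> 'v) \<Rightarrow> ('v \<Rightarrow> 'v) \<Rightarrow> 'v::euclidean_space \<Rightarrow> 'v" where
  "vf_bracket X Y = deriv_along X Y - deriv_along Y X"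

section \<open>Lie algebroids on trivial bundles\<close>

locale lie_algebra_on =
  fixes L :: "'l::real_vector set" and br :: "'l \<Rightarrow> 'l \<Rightarrow> 'l"
  assumes subspace: "subspace L"
    and closed: "\<And>a b. a \<in> L \<Longrightarrow> b \<in> L \<Longrightarrow> br a b \<in> L"
    and add_left: "\<And>a b c. a \<in> L \<Longrightarrow> b \<in> L \<Longrightarrow> c \<in> L \<Longrightarrow> br (a + b) c = br a c + br b c"
    and add_right: "\<And>a b c. a \<in> L \<Longrightarrow> b \<in> L \<Longrightarrow> c \<in> L \<Longrightarrow> br a (b + c) = br a b + br a c"
    and scale_left: "\<And>r a b. a \<in> L \<Longrightarrow> b \<in> L \<Longrightarrow> br (r *\<^sub>R a) b = r *\<^sub>R br a b"
    and scale_right: "\<And>r a b. a \<in> L \<Longrightarrow> b \<in> L \<Longrightarrow> br a (r *\<^sub>R b) = r *\<^sub>R br a b"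
    and alternating: "\<And>a. a \<in> L \<Longrightarrow> br a a = 0"
    and jacobi: "\<And>a b c. a \<in> L \<Longrightarrow> b \<in> L \<Longrightarrow> c \<in> L \<Longrightarrow>
      br a (br b c) + br b (br c a) + br c (br a b) = 0"

text \<open>Sections over \<open>U\<close> of the trivial bundle whose fibre is a finite-dimensional subspace \<open>E\<close> of
  some real vector space. The ambient space carries no norm, so smoothness is tested by linear
  functionals; since functionals on \<open>E\<close> extend to the ambient space, this says that the coordinates
  of the section with respect to a basis of \<open>E\<close> are smooth.\<close>

definition sections ::
  "'v::euclidean_space set \<Rightarrow> 'e::real_vector set \<Rightarrow> ('v \<Rightarrow> 'e) set" where
  "sections U E = {a \<in> U \<rightarrow>\<^sub>E E. \<forall>\<phi> :: 'e \<Rightarrow> real. linear \<phi> \<longrightarrow> smooth_on U (\<lambda>x. \<phi> (a x))}"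

text \<open>The bundle is \<open>V \<times> E \<rightarrow> V\<close> over the whole Euclidean space \<open>V\<close>; \<open>\<rho> x\<close> is the anchor on the
  fibre over \<open>x\<close>. The last assumption is well known to follow from the others; it is
  listed because it is often made part of the definition.\<close>

locale trivial_lie_algebroid =
  fixes E :: "'e::real_vector set"
    and \<rho> :: "'v::euclidean_space \<Rightarrow> 'e \<Rightarrow> 'v"
    and br :: "('v \<Rightarrow> 'e) \<Rightarrow> ('v \<Rightarrow> 'e) \<Rightarrow> ('v \<Rightarrow> 'e)"
  assumes fibre_subspace: "subspace E"
    and fibre_finite_dim: "\<exists>B. finite B \<and> span B = E"
    and anchor_add: "\<And>x e e'. e \<in> E \<Longrightarrow> e' \<in> E \<Longrightarrow> \<rho> x (e + e') = \<rho> x e + \<rho> x e'"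
    and anchor_scale: "\<And>x r e. e \<in> E \<Longrightarrow> \<rho> x (r *\<^sub>R e) = r *\<^sub>R \<rho> x e"
    and anchor_smooth: "\<And>e. e \<in> E \<Longrightarrow> smooth_on UNIV (\<lambda>x. \<rho> x e)"
    and lie_algebra: "lie_algebra_on (sections UNIV E) br"
    and leibniz: "\<And>a b f. a \<in> sections UNIV E \<Longrightarrow> b \<in> sections UNIV E \<Longrightarrow> f \<in> smooth_funs UNIV \<Longrightarrow>
      br a (\<lambda>x. f x *\<^sub>R b x) =
        (\<lambda>x. f x *\<^sub>R br a b x + deriv_along (\<lambda>y. \<rho> y (a y)) f x *\<^sub>R b x)"
    and anchor_bracket: "\<And>a b. a \<in> sections UNIV E \<Longrightarrow> b \<in> sections UNIV E \<Longrightarrow>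
      (\<lambda>x. \<rho> x (br a b x)) = vf_bracket (\<lambda>x. \<rho> x (a x)) (\<lambda>x. \<rho> x (b x))"

section \<open>The sheaf \<open>\<F>\<^sub>k\<close>\<close>

definition ideal0 :: "'v::euclidean_space set \<Rightarrow> ('v \<Rightarrow> real) set" where
  "ideal0 U = {f \<in> smooth_funs U. 0 \<in> U \<longrightarrow> f 0 = 0}"

definition foliation :: "nat \<Rightarrow> 'v::euclidean_space set \<Rightarrow> ('v \<Rightarrow> 'v) set" where
  "foliation k U = {X \<in> vector_fields U. \<forall>p\<in>U. \<exists>W. open W \<and> p \<in> W \<and> W \<subseteq> U \<and>
     (\<exists>(m::nat) (f :: nat \<Rightarrow> nat \<Rightarrow> 'v \<Rightarrow> real) (Y :: nat \<Rightarrow> 'v \<Rightarrow> 'v).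
        (\<forall>j<m. (\<forall>i<k. f j i \<in> ideal0 W) \<and> Y j \<in> vector_fields W) \<and>
        (\<forall>x\<in>W. X x = (\<Sum>j<m. (\<Prod>i<k. f j i x) *\<^sub>R Y j x)))}"

section \<open>The algebroid with fibre \<open>S\<^sup>kV\<^sup>* \<otimes> V\<close>\<close>

text \<open>A \<open>k\<close>-tuple is given by the first \<open>k\<close> entries of a sequence. The first condition below says
  that the other entries are irrelevant, so the elements correspond bijectively to symmetric
  \<open>k\<close>-linear maps \<open>V\<^sup>k \<rightarrow> V\<close>.\<close>

definition sym_multilinear :: "nat \<Rightarrow> ((nat \<Rightarrow> 'v::real_vector) \<Rightarrow> 'v) set" where
  "sym_multilinear k = {e.
     (\<forall>u v. (\<forall>i<k. u i = v i) \<longrightarrow> e u = e v) \<and>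
     (\<forall>u. \<forall>i<k. linear (\<lambda>w. e (u(i := w)))) \<and>
     (\<forall>\<pi> u. \<pi> permutes {..<k} \<longrightarrow> e (u \<circ> \<pi>) = e u)}"

definition anchor :: "'v \<Rightarrow> ((nat \<Rightarrow> 'v) \<Rightarrow> 'v) \<Rightarrow> 'v" where
  "anchor x e = e (\<lambda>_. x)"

definition anchor_on ::
  "'v set \<Rightarrow> ('v \<Rightarrow> (nat \<Rightarrow> 'v) \<Rightarrow> 'v) \<Rightarrow> 'v \<Rightarrow> 'v" where
  "anchor_on U a = (\<lambda>x\<in>U. anchor x (a x))"

text \<open>\<open>\<Lambda>\<^sub>a(u) = a\<^sub>x(x, \<dots>, x, u)\<close>, the argument \<open>u\<close> being in the last position \<open>k - 1\<close> (for \<open>k \<ge> 1\<close>).\<close>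

definition Lam :: "nat \<Rightarrow> ('v \<Rightarrow> (nat \<Rightarrow> 'v) \<Rightarrow> 'v) \<Rightarrow> 'v \<Rightarrow> 'v \<Rightarrow> 'v" where
  "Lam k a x u = a x ((\<lambda>_. x)(k - 1 := u))"

definition tri :: "nat \<Rightarrow> ('v \<Rightarrow> (nat \<Rightarrow> 'v) \<Rightarrow> 'v) \<Rightarrow> ('v \<Rightarrow> (nat \<Rightarrow> 'v) \<Rightarrow> 'v) \<Rightarrow>
    'v::euclidean_space \<Rightarrow> (nat \<Rightarrow> 'v) \<Rightarrow> 'v" where
  "tri k a b = (\<lambda>x u. deriv_along (\<lambda>y. anchor y (a y)) (\<lambda>y. b y u) x +
     (\<Sum>i<k. b x (u(i := Lam k a x (u i)))))"

definition bracket :: "nat \<Rightarrow> ('v \<Rightarrow> (nat \<Rightarrow> 'v) \<Rightarrow> 'v) \<Rightarrow> ('v \<Rightarrow> (nat \<Rightarrow> 'v) \<Rightarrow> 'v) \<Rightarrow>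
    'v::euclidean_space \<Rightarrow> (nat \<Rightarrow> 'v) \<Rightarrow> 'v" where
  "bracket k a b = tri k a b - tri k b a"

end

theory Submission
  imports Defs
begin

text \<open>
  Let \<open>T\<close> be an endomorphism field and let \<open>(T c)(u) = \<Sum>i. c(\<dots>, T u\<^sub>i, \<dots>)\<close> be its derivation action on
  families of multilinear maps. Then \<open>a \<triangleright> b = D\<^bsub>\<rho>(a)\<^esub> b + \<Lambda>\<^sub>a b\<close>, so \<open>a \<mapsto> a \<triangleright> _\<close> is a connection of
  \<open>A\<close> on itself, and the bracket is the one for which it is torsion-free. The algebroid axioms rest on two
  identities,
  \<open>\<rho>(a \<triangleright> b) = D\<^bsub>\<rho>(a)\<^esub> \<rho>(b)\<close> (\<open>anchor_field_tri\<close>) and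
  \<open>\<Lambda>\<^bsub>a \<triangleright> b\<^esub> = D\<^bsub>\<rho>(a)\<^esub> \<Lambda>\<^sub>b + \<Lambda>\<^sub>b \<circ> \<Lambda>\<^sub>a\<close> (\<open>Lam_tri\<close>),
  both of which are the product rule for \<open>x \<mapsto> b\<^sub>x(w(x))\<close>: an entry \<open>x\<close> of \<open>b\<close> is differentiated to
  \<open>\<rho>(a) = \<Lambda>\<^sub>a x\<close>, which is exactly what \<open>\<Lambda>\<^sub>a\<close> inserts in that entry. Antisymmetrising the first identity shows
  that the anchor respects brackets. Antisymmetrising the second one gives
  \<open>\<Lambda>\<^bsub>[a,b]\<^esub> = D\<^bsub>\<rho>(a)\<^esub> \<Lambda>\<^sub>b - D\<^bsub>\<rho>(b)\<^esub> \<Lambda>\<^sub>a + [\<Lambda>\<^sub>b, \<Lambda>\<^sub>a]\<close>; since second derivatives commute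
  and the action on multilinear maps reverses commutators, this says that the connection is flat,
  \<open>a \<triangleright> (b \<triangleright> c) - b \<triangleright> (a \<triangleright> c) = [a,b] \<triangleright> c\<close> (\<open>tri_flat\<close>). For a flat product the Jacobi identity of
  the commutator is formal.

  For the rank, the symmetrised products \<open>\<Sum>\<pi>. \<Prod>i. \<langle>u\<^bsub>\<pi> i\<^esub>, t\<^sub>i\<rangle> b\<close> with \<open>t\<^sub>1, \<dots>, t\<^sub>k, b\<close> in the standard
  basis span the fibre, depend on \<open>t\<close> only through the multiset of its entries, and are separated by evaluation
  at basis tuples (\<open>sym_multilinear_basis\<close>).

  The anchor maps sections into \<open>\<F>\<^sub>k\<close> because \<open>a\<^sub>x(x, \<dots>, x)\<close> expands into monomials of degree \<open>k\<close> in the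
  coordinates of \<open>x\<close>. Conversely, let \<open>X\<close> be in \<open>\<F>\<^sub>k(U)\<close>. Away from the origin,
  \<open>(\<Prod>i. \<langle>x, u\<^sub>i\<rangle> / |x|\<^sup>2) X(x)\<close> is a smooth lift of \<open>X\<close> (\<open>radial_lift\<close>). Near the origin, Hadamard's lemma
  writes a function \<open>f\<close> with \<open>f(0) = 0\<close> as \<open>f(x) = \<langle>x, g(x)\<rangle>\<close> with \<open>g\<close> smooth, and the symmetrisation of
  \<open>\<Prod>i. \<langle>u\<^sub>i, g\<^sub>i(x)\<rangle> Y(x)\<close> lifts \<open>f\<^sub>1 \<cdots> f\<^sub>k Y\<close> (\<open>local_lift_at_0\<close>). The anchor is linear on fibres,
  so interpolating between the two lifts with a bump function again gives a lift.
\<close>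

section \<open>Calculus of smooth maps\<close>

lemma differentiable_upto_cong:
  assumes "open U" "\<And>x. x \<in> U \<Longrightarrow> f x = g x"
  shows "differentiable_upto r U f \<longleftrightarrow> differentiable_upto r U g"
  using assms(2)
proof (induction r arbitrary: f g)
  case 0
  then show ?case by (auto intro!: continuous_on_cong)
next
  case (Suc r)
  have imp: "differentiable_upto (Suc r) U g'"
    if f': "differentiable_upto (Suc r) U f'" and eq: "\<And>x. x \<in> U \<Longrightarrow> f' x = g' x" for f' g' :: "'a \<Rightarrow> 'b"
  proof -
    have d: "g' differentiable (at x)" if "x \<in> U" for x
    proof -
      have "(f' has_derivative frechet_derivative f' (at x)) (at x)"
        using f' that by (simp add: frechet_derivative_works[symmetric])
      from has_derivative_transform_within_open[OF this assms(1) that eq]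
      show ?thesis by (auto simp: differentiable_def)
    qed
    have e: "frechet_derivative f' (at x) v = frechet_derivative g' (at x) v" if "x \<in> U" for x v
      using f' that eq assms(1) frechet_derivative_transform_within_open[of f' x U g'] by simp
    have "differentiable_upto r U (\<lambda>x. frechet_derivative g' (at x) v)" for v
      using f' Suc.IH[of "\<lambda>x. frechet_derivative f' (at x) v" "\<lambda>x. frechet_derivative g' (at x) v"] e
      by simp
    with d show ?thesis by simp
  qed
  show ?case
    by (rule iffI; erule imp) (simp_all add: Suc.prems)
qed

lemma differentiable_upto_subset:
  "differentiable_upto r U f \<Longrightarrow> W \<subseteq> U \<Longrightarrow> differentiable_upto r W f"
proof (induction r arbitrary: f)
  case 0
  then show ?case using continuous_on_subset by simp blast
next
  case (Suc r)
  then show ?case by auto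
qed

lemma differentiable_upto_Suc_imp:
  "differentiable_upto (Suc r) U f \<Longrightarrow> differentiable_upto r U f"
proof (induction r arbitrary: f)
  case 0
  then show ?case
    by (auto intro!: continuous_at_imp_continuous_on differentiable_imp_continuous_within)
next
  case (Suc r)
  have "differentiable_upto r U (\<lambda>x. frechet_derivative f (at x) v)" for v
    by (rule Suc.IH) (use Suc.prems in auto)
  then show ?case using Suc.prems by simp
qed

text \<open>Being \<open>C\<^sup>r\<close> is a local property; this is what makes gluing of smooth maps possible.\<close>

lemma differentiable_upto_locally:
  assumes "\<And>x. x \<in> U \<Longrightarrow> \<exists>W. open W \<and> x \<in> W \<and> differentiable_upto r W f"
  shows "differentiable_upto r U f"
  using assms
proof (induction r arbitrary: f)
  case 0
  have "continuous (at x) f" if "x \<in> U" for x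
    using 0[OF that] by (auto simp: continuous_on_eq_continuous_at)
  then show ?case by (simp add: continuous_at_imp_continuous_on)
next
  case (Suc r)
  have "differentiable_upto r U (\<lambda>x. frechet_derivative f (at x) v)" for v
  proof (rule Suc.IH)
    fix x assume "x \<in> U"
    then obtain W where "open W" "x \<in> W" "differentiable_upto (Suc r) W f"
      using Suc.prems by blast
    then show "\<exists>W. open W \<and> x \<in> W \<and> differentiable_upto r W (\<lambda>x. frechet_derivative f (at x) v)"
      by auto
  qed
  moreover have "f differentiable (at x)" if "x \<in> U" for x
    using Suc.prems[OF that] by auto
  ultimately show ?case by simp
qed

lemma frechet_derivative_eqI:
  "(f has_derivative f') (at x) \<Longrightarrow> frechet_derivative f (at x) = f'"
  by (rule frechet_derivative_at[symmetric])

text \<open>The derivative in the definition of \<open>C\<^sup>r\<close> is a choice that is meaningful only at points of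
  differentiability; this rule lets any known derivative on \<open>U\<close> take its place.\<close>

lemma differentiable_upto_SucI:
  assumes "open U" "\<And>x. x \<in> U \<Longrightarrow> (f has_derivative f' x) (at x)"
    and "\<And>v. differentiable_upto r U (\<lambda>x. f' x v)"
  shows "differentiable_upto (Suc r) U f"
proof -
  have "differentiable_upto r U (\<lambda>x. frechet_derivative f (at x) v)" for v
    by (rule iffD1[OF differentiable_upto_cong assms(3)[of v]])
      (simp_all add: assms(1) frechet_derivative_eqI[OF assms(2)])
  then show ?thesis using assms(2) by (auto simp: differentiable_def)
qed

lemma differentiable_upto_SucD:
  assumes "differentiable_upto (Suc r) U f"
  shows "x \<in> U \<Longrightarrow> (f has_derivative frechet_derivative f (at x)) (at x)"
    and "differentiable_upto r U (\<lambda>x. frechet_derivative f (at x) v)"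
  using assms frechet_derivative_works[of f "at x"] by simp_all

lemma differentiable_upto_const: "differentiable_upto r U (\<lambda>x. c)"
proof (induction r arbitrary: c)
  case (Suc r)
  then show ?case by simp
qed simp

lemma differentiable_upto_add:
  assumes "open U" "differentiable_upto r U f" "differentiable_upto r U g"
  shows "differentiable_upto r U (\<lambda>x. f x + g x)"
  using assms(2,3)
proof (induction r arbitrary: f g)
  case 0
  then show ?case by (simp add: continuous_on_add)
next
  case (Suc r)
  note D = differentiable_upto_SucD[OF Suc.prems(1)] differentiable_upto_SucD[OF Suc.prems(2)]
  show ?case
    by (rule differentiable_upto_SucI[OF assms(1) has_derivative_add[OF D(1,3)]])
      (assumption | intro Suc.IH D(2,4))+
qed

lemma differentiable_upto_linear:
  assumes "open U" "bounded_linear h" "differentiable_upto r U f"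
  shows "differentiable_upto r U (\<lambda>x. h (f x))"
  using assms(3)
proof (induction r arbitrary: f)
  case 0
  then show ?case by (simp add: bounded_linear.continuous_on[OF assms(2)])
next
  case (Suc r)
  note D = differentiable_upto_SucD[OF Suc.prems]
  show ?case
    by (rule differentiable_upto_SucI[OF assms(1) bounded_linear.has_derivative[OF assms(2) D(1)]])
      (assumption | intro Suc.IH D(2))+
qed

text \<open>All products in use (scalar, inner and real multiplication) are instances. The induction uses that the
  derivative of a product is a sum of products of maps of class \<open>C\<^sup>r\<close>.\<close>

lemma differentiable_upto_bilinear:
  assumes "open U" "bounded_bilinear h" "differentiable_upto r U f" "differentiable_upto r U g"
  shows "differentiable_upto r U (\<lambda>x. h (f x) (g x))"
  using assms(3,4)
proof (induction r arbitrary: f g)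
  case 0
  then show ?case by (simp add: bounded_bilinear.continuous_on[OF assms(2)])
next
  case (Suc r)
  note D = differentiable_upto_SucD[OF Suc.prems(1)] differentiable_upto_SucD[OF Suc.prems(2)]
  show ?case
    by (rule differentiable_upto_SucI[OF assms(1) bounded_bilinear.FDERIV[OF assms(2) D(1,3)]])
      (assumption | intro differentiable_upto_add assms(1) Suc.IH D(2,4)
        differentiable_upto_Suc_imp[OF Suc.prems(1)] differentiable_upto_Suc_imp[OF Suc.prems(2)])+
qed

lemma differentiable_upto_sum:
  assumes "open U" "\<And>i. i \<in> I \<Longrightarrow> differentiable_upto r U (f i)"
  shows "differentiable_upto r U (\<lambda>x. \<Sum>i\<in>I. f i x)"
  using assms(2)
  by (induction I rule: infinite_finite_induct)
    (simp_all add: differentiable_upto_const differentiable_upto_add assms(1))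

lemma linear_Basis_expansion:
  fixes h :: "'a::euclidean_space \<Rightarrow> 'b::real_vector"
  assumes "linear h"
  shows "h w = (\<Sum>b\<in>Basis. (w \<bullet> b) *\<^sub>R h b)"
proof -
  interpret linear h by fact
  have "h w = h (\<Sum>b\<in>Basis. (w \<bullet> b) *\<^sub>R b)" by (simp add: euclidean_representation)
  then show ?thesis by (simp add: sum scale)
qed

text \<open>In the inductive step the chain rule is rewritten as
  \<open>\<Sum>b. \<langle>Df(x) v, b\<rangle> Dg(f x) b\<close>, since only the derivative of \<open>g\<close> in a constant direction is covered by the
  induction hypothesis.\<close>

lemma differentiable_upto_compose:
  fixes f :: "'a::euclidean_space \<Rightarrow> 'b::euclidean_space" and g :: "'b \<Rightarrow> 'c::real_normed_vector"
  assumes "open U" "open T" "f ` U \<subseteq> T" "differentiable_upto r U f" "differentiable_upto r T g"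
  shows "differentiable_upto r U (\<lambda>x. g (f x))"
  using assms(4,5)
proof (induction r arbitrary: g)
  case 0
  then show ?case using continuous_on_compose2[of T g U f] assms(3) by simp
next
  case (Suc r)
  note D = differentiable_upto_SucD[OF Suc.prems(1)] differentiable_upto_SucD[OF Suc.prems(2)]
  have du_f: "differentiable_upto r U f" by (rule differentiable_upto_Suc_imp[OF Suc.prems(1)])
  show ?case
  proof (rule differentiable_upto_SucI[OF assms(1)])
    fix x assume x: "x \<in> U"
    then have fx: "f x \<in> T" using assms(3) by auto
    have eq: "frechet_derivative g (at (f x)) \<circ> frechet_derivative f (at x) =
        (\<lambda>v. \<Sum>b\<in>Basis. (frechet_derivative f (at x) v \<bullet> b) *\<^sub>R frechet_derivative g (at (f x)) b)"
      unfolding comp_def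
      by (rule ext) (rule linear_Basis_expansion[OF has_derivative_linear[OF D(3)[OF fx]]])
    show "((\<lambda>x. g (f x)) has_derivative
        (\<lambda>v. \<Sum>b\<in>Basis. (frechet_derivative f (at x) v \<bullet> b) *\<^sub>R frechet_derivative g (at (f x)) b)) (at x)"
      using diff_chain_at[OF D(1)[OF x] D(3)[OF fx]] unfolding eq by (simp only: comp_def)
  next
    fix v
    show "differentiable_upto r U (\<lambda>x. \<Sum>b\<in>Basis. (frechet_derivative f (at x) v \<bullet> b) *\<^sub>R
        frechet_derivative g (at (f x)) b)"
      by (intro differentiable_upto_sum assms(1)
          differentiable_upto_bilinear[OF _ bounded_bilinear_scaleR]
          differentiable_upto_linear[OF _ bounded_linear_inner_left] D(2) Suc.IH D(4) du_f)
  qed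
qed

lemma smooth_onD: "smooth_on U f \<Longrightarrow> differentiable_upto r U f"
  by (simp add: smooth_on_def)

lemma smooth_on_cong:
  "open U \<Longrightarrow> (\<And>x. x \<in> U \<Longrightarrow> f x = g x) \<Longrightarrow> smooth_on U f \<longleftrightarrow> smooth_on U g"
  unfolding smooth_on_def using differentiable_upto_cong[of U f g] by simp

lemma smooth_on_subset: "smooth_on U f \<Longrightarrow> W \<subseteq> U \<Longrightarrow> smooth_on W f"
  unfolding smooth_on_def using differentiable_upto_subset by blast

lemma smooth_on_locally:
  assumes "\<And>x. x \<in> U \<Longrightarrow> \<exists>W. open W \<and> x \<in> W \<and> smooth_on W f"
  shows "smooth_on U f"
  unfolding smooth_on_def
  by (intro allI differentiable_upto_locally) (use assms in \<open>auto simp: smooth_on_def\<close>)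

lemma smooth_on_has_derivative:
  "smooth_on U f \<Longrightarrow> x \<in> U \<Longrightarrow> (f has_derivative frechet_derivative f (at x)) (at x)"
  by (rule differentiable_upto_SucD(1)[OF smooth_onD[of U f "Suc 0"]])

lemma smooth_on_linear_derivative:
  "smooth_on U f \<Longrightarrow> x \<in> U \<Longrightarrow> linear (frechet_derivative f (at x))"
  by (rule has_derivative_linear[OF smooth_on_has_derivative])

lemma smooth_on_frechet_derivative:
  "smooth_on U f \<Longrightarrow> smooth_on U (\<lambda>x. frechet_derivative f (at x) v)"
  unfolding smooth_on_def[of U "\<lambda>x. frechet_derivative f (at x) v"]
  by (intro allI differentiable_upto_SucD(2) smooth_onD)

lemma smooth_on_continuous: "smooth_on U f \<Longrightarrow> continuous_on U f"
  using smooth_onD[of U f 0] by simp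

lemma smooth_on_const: "smooth_on U (\<lambda>x. c)"
  by (simp add: smooth_on_def differentiable_upto_const)

lemma smooth_on_ident: "open U \<Longrightarrow> smooth_on U (\<lambda>x. x)"
  unfolding smooth_on_def
proof
  fix r :: nat assume "open U"
  show "differentiable_upto r U (\<lambda>x. x)"
  proof (cases r)
    case (Suc r')
    show ?thesis unfolding Suc
      by (rule differentiable_upto_SucI[OF \<open>open U\<close> has_derivative_ident differentiable_upto_const])
  qed simp
qed

lemma smooth_on_add:
  "open U \<Longrightarrow> smooth_on U f \<Longrightarrow> smooth_on U g \<Longrightarrow> smooth_on U (\<lambda>x. f x + g x)"
  by (simp add: smooth_on_def differentiable_upto_add)

lemma smooth_on_sum:
  "open U \<Longrightarrow> (\<And>i. i \<in> I \<Longrightarrow> smooth_on U (f i)) \<Longrightarrow> smooth_on U (\<lambda>x. \<Sum>i\<in>I. f i x)"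
  by (simp add: smooth_on_def differentiable_upto_sum)

lemma smooth_on_linear:
  "open U \<Longrightarrow> bounded_linear h \<Longrightarrow> smooth_on U f \<Longrightarrow> smooth_on U (\<lambda>x. h (f x))"
  by (simp add: smooth_on_def differentiable_upto_linear)

lemma smooth_on_bilinear:
  "open U \<Longrightarrow> bounded_bilinear h \<Longrightarrow> smooth_on U f \<Longrightarrow> smooth_on U g \<Longrightarrow>
    smooth_on U (\<lambda>x. h (f x) (g x))"
  by (simp add: smooth_on_def differentiable_upto_bilinear)

lemmas smooth_on_scaleR = smooth_on_bilinear[OF _ bounded_bilinear_scaleR]
lemmas smooth_on_mult = smooth_on_bilinear[OF _ bounded_bilinear_mult]
lemmas smooth_on_inner = smooth_on_bilinear[OF _ bounded_bilinear_inner]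

lemma smooth_on_scale_const: "open U \<Longrightarrow> smooth_on U f \<Longrightarrow> smooth_on U (\<lambda>x. c *\<^sub>R f x)"
  by (intro smooth_on_scaleR smooth_on_const)

lemma smooth_on_minus: "open U \<Longrightarrow> smooth_on U f \<Longrightarrow> smooth_on U (\<lambda>x. - f x)"
  by (rule smooth_on_linear[OF _ bounded_linear_minus[OF bounded_linear_ident]])

lemma smooth_on_diff:
  "open U \<Longrightarrow> smooth_on U f \<Longrightarrow> smooth_on U g \<Longrightarrow> smooth_on U (\<lambda>x. f x - g x)"
  using smooth_on_add[of U f "\<lambda>x. - g x"] smooth_on_minus[of U g] by simp

lemma smooth_on_prod:
  fixes f :: "'i \<Rightarrow> 'a::euclidean_space \<Rightarrow> real"
  assumes "open U" "\<And>i. i \<in> I \<Longrightarrow> smooth_on U (f i)"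
  shows "smooth_on U (\<lambda>x. \<Prod>i\<in>I. f i x)"
  using assms(2)
  by (induction I rule: infinite_finite_induct)
    (simp_all add: smooth_on_const smooth_on_mult assms(1))

lemma smooth_on_compose:
  fixes f :: "'a::euclidean_space \<Rightarrow> 'b::euclidean_space" and g :: "'b \<Rightarrow> 'c::real_normed_vector"
  shows "open U \<Longrightarrow> open T \<Longrightarrow> f ` U \<subseteq> T \<Longrightarrow> smooth_on U f \<Longrightarrow> smooth_on T g \<Longrightarrow>
    smooth_on U (\<lambda>x. g (f x))"
  unfolding smooth_on_def using differentiable_upto_compose by blast

lemma smooth_on_componentwise:
  fixes f :: "'a::euclidean_space \<Rightarrow> 'b::euclidean_space"
  assumes "open U" "\<And>b. b \<in> Basis \<Longrightarrow> smooth_on U (\<lambda>x. f x \<bullet> b)"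
  shows "smooth_on U f"
proof -
  have "smooth_on U (\<lambda>x. \<Sum>b\<in>Basis. (f x \<bullet> b) *\<^sub>R b)"
    by (intro smooth_on_sum smooth_on_scaleR smooth_on_const assms)
  then show ?thesis by (simp add: euclidean_representation)
qed

text \<open>Replaces the varying direction \<open>X x\<close> by constant ones, for which smoothness of the derivative is part
  of the definition of smoothness.\<close>

lemma deriv_along_expansion:
  "smooth_on U f \<Longrightarrow> x \<in> U \<Longrightarrow>
    deriv_along X f x = (\<Sum>b\<in>Basis. (X x \<bullet> b) *\<^sub>R frechet_derivative f (at x) b)"
  unfolding deriv_along_def by (intro linear_Basis_expansion smooth_on_linear_derivative)

lemma smooth_on_deriv_along:
  assumes "open U" "smooth_on U X" "smooth_on U f"
  shows "smooth_on U (deriv_along X f)"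
proof -
  have "smooth_on U (\<lambda>x. \<Sum>b\<in>Basis. (X x \<bullet> b) *\<^sub>R frechet_derivative f (at x) b)"
    by (intro smooth_on_sum smooth_on_scaleR smooth_on_inner smooth_on_const
        smooth_on_frechet_derivative assms)
  then show ?thesis
    using smooth_on_cong[OF assms(1), of "deriv_along X f"] deriv_along_expansion[OF assms(3)]
    by simp
qed

section \<open>Symmetry of second derivatives\<close>

text \<open>Two applications of the mean value theorem to the second difference of \<open>f\<close> over a small parallelogram.
  The left-hand side is symmetric in \<open>v\<close> and \<open>w\<close>, whence the symmetry of the second derivative below.\<close>

lemma mixed_difference:
  fixes f :: "'a::euclidean_space \<Rightarrow> real"
  assumes f: "smooth_on U f" and U: "ball x e \<subseteq> U" and t: "t > 0" "t * (norm v + norm w) < e"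
  shows "\<exists>p\<in>ball x e. f (x + t *\<^sub>R v + t *\<^sub>R w) - f (x + t *\<^sub>R v) - f (x + t *\<^sub>R w) + f x =
    t\<^sup>2 * frechet_derivative (\<lambda>y. frechet_derivative f (at y) v) (at p) w"
proof -
  let ?D = "\<lambda>y. frechet_derivative f (at y)"
  have in_ball: "x + s *\<^sub>R v + s' *\<^sub>R w \<in> ball x e" if "0 \<le> s" "s \<le> t" "0 \<le> s'" "s' \<le> t" for s s'
  proof -
    have "norm (s *\<^sub>R v + s' *\<^sub>R w) \<le> norm (s *\<^sub>R v) + norm (s' *\<^sub>R w)" by (rule norm_triangle_ineq)
    also have "\<dots> \<le> t * norm v + t * norm w"
      using that by (auto intro!: add_mono mult_right_mono)
    finally have "norm (s *\<^sub>R v + s' *\<^sub>R w) < e"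
      using t(2) by (simp add: distrib_left)
    moreover have "x - (x + s *\<^sub>R v + s' *\<^sub>R w) = - (s *\<^sub>R v + s' *\<^sub>R w)" by simp
    then have "dist x (x + s *\<^sub>R v + s' *\<^sub>R w) = norm (s *\<^sub>R v + s' *\<^sub>R w)"
      by (simp only: dist_norm norm_minus_cancel)
    ultimately have "dist x (x + s *\<^sub>R v + s' *\<^sub>R w) < e" by simp
    then show ?thesis by simp
  qed
  have df: "(f has_derivative ?D y) (at y)" if "y \<in> ball x e" for y
    using smooth_on_has_derivative[OF f] U that by blast
  have dDf: "((\<lambda>y. ?D y v) has_derivative frechet_derivative (\<lambda>y. ?D y v) (at y)) (at y)"
    if "y \<in> ball x e" for y
    using smooth_on_has_derivative[OF smooth_on_frechet_derivative[OF f]] U that by blast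
  \<comment> \<open>The second difference is the increment of \<open>\<phi>\<close> from \<open>0\<close> to \<open>t\<close>.\<close>
  let ?\<phi> = "\<lambda>s. f (x + s *\<^sub>R v + t *\<^sub>R w) - f (x + s *\<^sub>R v)"
  let ?\<phi>' = "\<lambda>s. ?D (x + s *\<^sub>R v + t *\<^sub>R w) v - ?D (x + s *\<^sub>R v) v"
  have path: "((\<lambda>s. f (x + s *\<^sub>R v + c)) has_real_derivative ?D (x + s *\<^sub>R v + c) v) (at s)"
    if "x + s *\<^sub>R v + c \<in> ball x e" for s c
  proof -
    have "((\<lambda>s. x + s *\<^sub>R v + c) has_derivative (\<lambda>h. h *\<^sub>R v)) (at s)"
      by (auto intro!: derivative_eq_intros)
    from diff_chain_at[OF this df[OF that]]
    show ?thesis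
      by (simp add: o_def has_field_derivative_def linear_cmul[OF has_derivative_linear[OF df[OF that]]]
          mult.commute[of _ "frechet_derivative f _ v"])
  qed
  have "\<exists>s. 0 < s \<and> s < t \<and> ?\<phi> t - ?\<phi> 0 = (t - 0) * ?\<phi>' s"
  proof (rule MVT2[OF t(1)])
    fix s :: real assume s: "0 \<le> s" "s \<le> t"
    show "(?\<phi> has_real_derivative ?\<phi>' s) (at s)"
      using DERIV_diff[OF path[of s "t *\<^sub>R w"] path[of s 0]] in_ball[of s t] in_ball[of s 0] s t(1)
      by simp
  qed
  then obtain s where s: "0 < s" "s < t" "?\<phi> t - ?\<phi> 0 = t * ?\<phi>' s" by auto
  let ?\<psi> = "\<lambda>s'. ?D (x + s *\<^sub>R v + s' *\<^sub>R w) v"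
  have "\<exists>s'. 0 < s' \<and> s' < t \<and> ?\<psi> t - ?\<psi> 0 =
      (t - 0) * frechet_derivative (\<lambda>y. ?D y v) (at (x + s *\<^sub>R v + s' *\<^sub>R w)) w"
  proof (rule MVT2[OF t(1)])
    fix s' :: real assume s': "0 \<le> s'" "s' \<le> t"
    let ?p = "x + s *\<^sub>R v + s' *\<^sub>R w"
    have p: "?p \<in> ball x e" using in_ball[of s s'] s s' by simp
    have "((\<lambda>s'. x + s *\<^sub>R v + s' *\<^sub>R w) has_derivative (\<lambda>h. h *\<^sub>R w)) (at s')"
      by (auto intro!: derivative_eq_intros)
    from diff_chain_at[OF this dDf[OF p]]
    show "(?\<psi> has_real_derivative frechet_derivative (\<lambda>y. ?D y v) (at ?p) w) (at s')"
      by (simp add: o_def has_field_derivative_def linear_cmul[OF has_derivative_linear[OF dDf[OF p]]]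
          mult.commute[of _ "frechet_derivative _ _ w"])
  qed
  then obtain s' where s': "0 < s'" "s' < t"
    "?\<psi> t - ?\<psi> 0 = t * frechet_derivative (\<lambda>y. ?D y v) (at (x + s *\<^sub>R v + s' *\<^sub>R w)) w" by auto
  have "x + s *\<^sub>R v + s' *\<^sub>R w \<in> ball x e" using in_ball s s' by simp
  moreover have "f (x + t *\<^sub>R v + t *\<^sub>R w) - f (x + t *\<^sub>R v) - f (x + t *\<^sub>R w) + f x =
    t\<^sup>2 * frechet_derivative (\<lambda>y. ?D y v) (at (x + s *\<^sub>R v + s' *\<^sub>R w)) w"
    using s(3) s'(3) by (simp add: power2_eq_square)
  ultimately show ?thesis by blast
qed

text \<open>By \<open>mixed_difference\<close>, both mixed derivatives take a common value at points arbitrarily close to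
  \<open>x\<close>; continuity does the rest.\<close>

lemma second_derivative_symmetric_real:
  fixes f :: "'a::euclidean_space \<Rightarrow> real"
  assumes "open U" and f: "smooth_on U f" and x: "x \<in> U"
  shows "frechet_derivative (\<lambda>y. frechet_derivative f (at y) v) (at x) w =
    frechet_derivative (\<lambda>y. frechet_derivative f (at y) w) (at x) v"
proof -
  let ?H = "\<lambda>v w y. frechet_derivative (\<lambda>y. frechet_derivative f (at y) v) (at y) w"
  have cont: "isCont (?H v w) x" for v w
    using smooth_on_continuous[OF smooth_on_frechet_derivative[OF smooth_on_frechet_derivative[OF f]]]
      \<open>open U\<close> x continuous_on_eq_continuous_at by blast
  have near: "\<bar>?H v w x - ?H w v x\<bar> \<le> 2 * \<epsilon>" if eps: "\<epsilon> > 0" for \<epsilon> :: real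
  proof -
    obtain d1 where d1: "d1 > 0" "\<And>y. dist y x < d1 \<Longrightarrow> dist (?H v w y) (?H v w x) < \<epsilon>"
      using cont[of v w, unfolded continuous_at_eps_delta, rule_format, OF eps] by auto
    obtain d2 where d2: "d2 > 0" "\<And>y. dist y x < d2 \<Longrightarrow> dist (?H w v y) (?H w v x) < \<epsilon>"
      using cont[of w v, unfolded continuous_at_eps_delta, rule_format, OF eps] by auto
    obtain d3 where d3: "d3 > 0" "ball x d3 \<subseteq> U"
      using \<open>open U\<close> x open_contains_ball by blast
    define e where "e = min d1 (min d2 d3)"
    have e: "e > 0" "ball x e \<subseteq> U" using d1 d2 d3 by (auto simp: e_def)
    \<comment> \<open>Small enough for the parallelogram to stay in the ball, also when \<open>v = w = 0\<close>.\<close>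
    define t where "t = e / (2 * (norm v + norm w + 1))"
    have N: "norm v + norm w + 1 > 0" using norm_ge_zero[of v] norm_ge_zero[of w] by linarith
    have t: "t > 0" using e(1) N unfolding t_def by (intro divide_pos_pos mult_pos_pos) auto
    have "t * (norm v + norm w) < t * (norm v + norm w + 1) * 2"
    proof -
      have "t * (norm v + norm w) < t * (norm v + norm w + 1)"
        using t by (intro mult_strict_left_mono) auto
      moreover have "0 < t * (norm v + norm w + 1)" using t N by simp
      ultimately show ?thesis by linarith
    qed
    also have "\<dots> = e" using N by (simp add: t_def field_simps)
    finally have te: "t * (norm v + norm w) < e" .
    obtain p where p: "p \<in> ball x e"
      "f (x + t *\<^sub>R v + t *\<^sub>R w) - f (x + t *\<^sub>R v) - f (x + t *\<^sub>R w) + f x = t\<^sup>2 * ?H v w p"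
      using mixed_difference[OF f e(2) t te] by blast
    obtain q where q: "q \<in> ball x e"
      "f (x + t *\<^sub>R w + t *\<^sub>R v) - f (x + t *\<^sub>R w) - f (x + t *\<^sub>R v) + f x = t\<^sup>2 * ?H w v q"
      using mixed_difference[OF f e(2) t, of w v] te by (auto simp: add.commute)
    have swap: "x + t *\<^sub>R w + t *\<^sub>R v = x + t *\<^sub>R v + t *\<^sub>R w" by (simp add: algebra_simps)
    have "t\<^sup>2 * ?H v w p =
        f (x + t *\<^sub>R w + t *\<^sub>R v) - f (x + t *\<^sub>R w) - f (x + t *\<^sub>R v) + f x"
      unfolding swap using p(2) by linarith
    also have "\<dots> = t\<^sup>2 * ?H w v q" by (rule q(2))
    finally have "?H v w p = ?H w v q" using t by simp
    moreover have "dist (?H v w p) (?H v w x) < \<epsilon>"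
      using p(1) d1(2)[of p] by (simp add: e_def dist_commute)
    moreover have "dist (?H w v q) (?H w v x) < \<epsilon>"
      using q(1) d2(2)[of q] by (simp add: e_def dist_commute)
    ultimately show ?thesis unfolding dist_real_def by linarith
  qed
  have "\<bar>?H v w x - ?H w v x\<bar> \<le> 0"
  proof (rule field_le_epsilon)
    fix \<epsilon> :: real assume "0 < \<epsilon>"
    then have "\<bar>?H v w x - ?H w v x\<bar> \<le> 2 * (\<epsilon> / 2)" by (intro near) simp
    then show "\<bar>?H v w x - ?H w v x\<bar> \<le> 0 + \<epsilon>" by simp
  qed
  then show ?thesis by simp
qed

lemma frechet_derivative_linear:
  "bounded_linear h \<Longrightarrow> (f has_derivative f') (at x) \<Longrightarrow>
    frechet_derivative (\<lambda>y. h (f y)) (at x) v = h (f' v)"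
  by (simp add: frechet_derivative_eqI[OF bounded_linear.has_derivative])

lemma second_derivative_symmetric:
  fixes f :: "'a::euclidean_space \<Rightarrow> 'b::euclidean_space"
  assumes "open U" and f: "smooth_on U f" and x: "x \<in> U"
  shows "frechet_derivative (\<lambda>y. frechet_derivative f (at y) v) (at x) w =
    frechet_derivative (\<lambda>y. frechet_derivative f (at y) w) (at x) v"
proof (rule euclidean_eqI)
  fix b :: 'b assume b: "b \<in> Basis"
  note lin = bounded_linear_inner_left[of b]
  have eq: "frechet_derivative (\<lambda>y. frechet_derivative f (at y) v) (at x) w \<bullet> b =
    frechet_derivative (\<lambda>y. frechet_derivative (\<lambda>z. f z \<bullet> b) (at y) v) (at x) w" for v w
  proof -
    have d: "((\<lambda>y. frechet_derivative f (at y) v \<bullet> b) has_derivative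
        (\<lambda>w. frechet_derivative (\<lambda>y. frechet_derivative f (at y) v) (at x) w \<bullet> b)) (at x)"
      by (intro bounded_linear.has_derivative[OF lin]
          smooth_on_has_derivative[OF smooth_on_frechet_derivative[OF f] x])
    have "((\<lambda>y. frechet_derivative (\<lambda>z. f z \<bullet> b) (at y) v) has_derivative
        (\<lambda>w. frechet_derivative (\<lambda>y. frechet_derivative f (at y) v) (at x) w \<bullet> b)) (at x)"
      by (rule has_derivative_transform_within_open[OF d \<open>open U\<close> x])
        (simp add: frechet_derivative_linear[OF lin smooth_on_has_derivative[OF f]])
    then show ?thesis by (simp add: frechet_derivative_eqI)
  qed
  show "frechet_derivative (\<lambda>y. frechet_derivative f (at y) v) (at x) w \<bullet> b =
    frechet_derivative (\<lambda>y. frechet_derivative f (at y) w) (at x) v \<bullet> b"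
    unfolding eq by (intro second_derivative_symmetric_real[OF \<open>open U\<close> _ x]
        smooth_on_inner[OF \<open>open U\<close> f smooth_on_const])
qed

section \<open>Bump functions\<close>

text \<open>\<open>flat_exp 0\<close> is Cauchy's function \<open>exp (-1/t)\<close>, extended by \<open>0\<close> to \<open>t \<le> 0\<close>. Multiplying by powers
  of \<open>1/t\<close> gives a family whose span is closed under differentiation, so that smoothness of all members follows by
  one induction.\<close>

definition flat_exp :: "nat \<Rightarrow> real \<Rightarrow> real" where
  "flat_exp m t = (if t > 0 then exp (- inverse t) * inverse t ^ m else 0)"

lemma flat_exp_tendsto_0: "(flat_exp m \<longlongrightarrow> 0) (at 0)"
proof -
  have "((\<lambda>s::real. s ^ m / exp s) \<longlongrightarrow> 0) at_top" by (rule tendsto_power_div_exp_0)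
  then have "((\<lambda>t. inverse t ^ m / exp (inverse t)) \<longlongrightarrow> 0) (at_right (0::real))"
    by (rule filterlim_compose[OF _ filterlim_inverse_at_top_right])
  then have "(flat_exp m \<longlongrightarrow> 0) (at_right 0)"
    by (rule filterlim_cong[OF refl refl, THEN iffD1, rotated])
      (auto simp: flat_exp_def eventually_at_right_less exp_minus field_simps
        intro: eventually_mono[OF eventually_at_right_less])
  moreover have "(flat_exp m \<longlongrightarrow> 0) (at_left 0)"
    by (rule tendsto_eventually) (auto simp: flat_exp_def eventually_at_filter)
  ultimately show ?thesis by (simp add: filterlim_split_at)
qed

lemma flat_exp_DERIV:
  "(flat_exp m has_real_derivative flat_exp (m + 2) t - m * flat_exp (m + 1) t) (at t)"
proof -
  consider "t > 0" | "t < 0" | "t = 0" by linarith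
  then show ?thesis
  proof cases
    case 1
    have "((\<lambda>t. exp (- inverse t) * inverse t ^ m) has_real_derivative
        flat_exp (m + 2) t - m * flat_exp (m + 1) t) (at t)"
    proof -
      have inv: "(inverse has_real_derivative - (inverse t ^ 2)) (at t)"
        using DERIV_inverse[of t] 1 by (simp add: numeral_2_eq_2)
      have pow: "((\<lambda>t. inverse t ^ m) has_real_derivative
          real m * (- (inverse t ^ 2) * inverse t ^ (m - Suc 0))) (at t)"
        by (rule DERIV_power[OF inv])
      have "((\<lambda>t. exp (- inverse t)) has_real_derivative exp (- inverse t) * - (- (inverse t ^ 2))) (at t)"
        by (rule DERIV_fun_exp[OF DERIV_minus[OF inv]])
      from DERIV_mult[OF this pow] show ?thesis
        by (rule DERIV_cong) (use 1 in \<open>cases m; simp add: flat_exp_def algebra_simps power2_eq_square\<close>)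
    qed
    then show ?thesis
      by (rule has_field_derivative_transform_within_open[of _ _ _ "{0<..}"])
        (use 1 in \<open>auto simp: flat_exp_def\<close>)
  next
    case 2
    have "((\<lambda>t. 0) has_real_derivative flat_exp (m + 2) t - m * flat_exp (m + 1) t) (at t)"
      using 2 by (simp add: flat_exp_def)
    then show ?thesis
      by (rule has_field_derivative_transform_within_open[of _ _ _ "{..<0}"])
        (use 2 in \<open>auto simp: flat_exp_def\<close>)
  next
    case 3
    \<comment> \<open>The difference quotient at \<open>0\<close> is \<open>flat_exp (m + 1)\<close>, and the claimed derivative is \<open>0\<close>.\<close>
    have "((\<lambda>h. (flat_exp m (0 + h) - flat_exp m 0) / h) \<longlongrightarrow> 0) (at 0)"
      by (rule filterlim_cong[OF refl refl, THEN iffD1, OF _ flat_exp_tendsto_0[of "m + 1"]])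
        (auto simp: flat_exp_def eventually_at_filter field_simps)
    then show ?thesis using 3 by (simp add: DERIV_def flat_exp_def)
  qed
qed

lemma smooth_on_flat_exp: "smooth_on UNIV (flat_exp m)"
proof -
  have "differentiable_upto r UNIV (flat_exp m)" for r
  proof (induction r arbitrary: m)
    case 0
    show ?case
      by (simp add: DERIV_continuous_on[OF flat_exp_DERIV])
  next
    case (Suc r)
    have "differentiable_upto r UNIV
        (\<lambda>t. v *\<^sub>R (flat_exp (m + 2) t + (- real m) *\<^sub>R flat_exp (m + 1) t))" for v :: real
      by (intro differentiable_upto_linear[OF _ bounded_linear_scaleR_right] differentiable_upto_add
          Suc.IH open_UNIV)
    then have "differentiable_upto r UNIV
        (\<lambda>t. (flat_exp (m + 2) t - m * flat_exp (m + 1) t) * v)" for v :: real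
      by (simp add: mult.commute)
    then show ?case
      by (intro differentiable_upto_SucI[where f' = "\<lambda>t. (*) (flat_exp (m + 2) t - m * flat_exp (m + 1) t)"]
          flat_exp_DERIV[unfolded has_field_derivative_def]) auto
  qed
  then show ?thesis by (simp add: smooth_on_def)
qed

text \<open>\<open>1/t\<close> is of every class \<open>C\<^sup>r\<close> on the positive reals, because its derivative is a polynomial in \<open>1/t\<close>
  itself.\<close>

lemma smooth_on_inverse_pos:
  fixes f :: "'a::euclidean_space \<Rightarrow> real"
  assumes "open U" "smooth_on U f" "\<And>x. x \<in> U \<Longrightarrow> f x > 0"
  shows "smooth_on U (\<lambda>x. inverse (f x))"
proof -
  have "differentiable_upto r {0<..} (\<lambda>t::real. inverse t)" for r
  proof (induction r)
    case 0
    show ?case by (auto intro!: continuous_intros)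
  next
    case (Suc r)
    note mult = differentiable_upto_bilinear[OF open_greaterThan bounded_bilinear_mult]
    have "differentiable_upto r {0<..} (\<lambda>t::real. - 1 * (inverse t * (v * inverse t)))" for v
      by (intro mult differentiable_upto_const Suc.IH)
    then have "differentiable_upto r {0<..} (\<lambda>t::real. - (inverse t * v * inverse t))" for v
      by (simp add: mult.assoc)
    then show ?case
      by (intro differentiable_upto_SucI[where f' = "\<lambda>t v. - (inverse t * v * inverse t)"]
          has_derivative_inverse') auto
  qed
  then show ?thesis
    using smooth_on_compose[OF assms(1) open_greaterThan[of "0::real"] _ assms(2)] assms(3)
    by (auto simp: smooth_on_def[of "{0<..}"])
qed

text \<open>The quotient \<open>p / (p + q)\<close>, where \<open>p\<close> is positive exactly for \<open>|x| < 2 r\<close> and \<open>q\<close> exactly for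
  \<open>|x| > r\<close>; one of the two is always positive.\<close>

lemma smooth_bump:
  fixes r :: real
  assumes "r > 0"
  obtains \<psi> :: "'a::euclidean_space \<Rightarrow> real" where
    "smooth_on UNIV \<psi>" "\<And>x. norm x < r \<Longrightarrow> \<psi> x = 1" "\<And>x. norm x > 2 * r \<Longrightarrow> \<psi> x = 0"
proof
  let ?p = "\<lambda>x::'a. flat_exp 0 (4 * r\<^sup>2 - x \<bullet> x)" and ?q = "\<lambda>x::'a. flat_exp 0 (x \<bullet> x - r\<^sup>2)"
  have pos: "?p x + ?q x > 0" for x
    using assms by (auto simp: flat_exp_def add_pos_pos) (smt (verit) zero_less_power)
  have sp: "smooth_on UNIV ?p" and sq: "smooth_on UNIV ?q"
    by (intro smooth_on_compose[OF open_UNIV open_UNIV subset_UNIV _ smooth_on_flat_exp]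
        smooth_on_diff smooth_on_const smooth_on_inner smooth_on_ident open_UNIV)+
  show "smooth_on UNIV (\<lambda>x. ?p x * inverse (?p x + ?q x))"
    by (intro smooth_on_mult smooth_on_inverse_pos smooth_on_add sp sq open_UNIV pos)
  show "?p x * inverse (?p x + ?q x) = 1" if "norm x < r" for x
  proof -
    have "x \<bullet> x < r\<^sup>2"
      using that by (simp add: power_strict_mono flip: power2_norm_eq_inner)
    then have "?q x = 0" by (simp add: flat_exp_def)
    then show ?thesis using pos[of x] by simp
  qed
  show "?p x * inverse (?p x + ?q x) = 0" if "norm x > 2 * r" for x
  proof -
    have "(2 * r)\<^sup>2 < x \<bullet> x"
      using that assms power_strict_mono[of "2 * r" "norm x" 2] by (simp flip: power2_norm_eq_inner)
    then have "?p x = 0" by (simp add: flat_exp_def power_mult_distrib)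
    then show ?thesis by simp
  qed
qed

section \<open>Hadamard's lemma\<close>

lemma scaleR_in_ball_0: "x \<in> ball 0 e \<Longrightarrow> t \<in> {0..1} \<Longrightarrow> t *\<^sub>R x \<in> ball 0 e"
  for x :: "'a::euclidean_space"
  using mult_left_le_one_le[of "norm x" t] by auto

lemma continuous_on_ray:
  fixes h :: "'a::euclidean_space \<Rightarrow> 'b::real_normed_vector"
  assumes "continuous_on (ball 0 e) h"
  shows "continuous_on (ball 0 e \<times> {0..1}) (\<lambda>(x, t). t ^ m *\<^sub>R h (t *\<^sub>R x))"
  unfolding case_prod_beta
  by (intro continuous_on_scaleR continuous_on_power continuous_on_snd continuous_on_id
      continuous_on_compose2[OF assms] continuous_on_fst)
    (auto simp del: mem_ball mem_ball_0 intro!: scaleR_in_ball_0)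

text \<open>Differentiating \<open>h(t x)\<close> in \<open>x\<close> under the integral produces a further factor \<open>t\<close>; the weight \<open>t ^ m\<close>
  absorbs it, so that the induction on the differentiability class closes.\<close>

lemma differentiable_upto_ray_average:
  fixes h :: "'a::euclidean_space \<Rightarrow> real"
  assumes h: "smooth_on (ball 0 e) h"
  shows "differentiable_upto r (ball 0 e) (\<lambda>x. integral {0..1} (\<lambda>t. t ^ m *\<^sub>R h (t *\<^sub>R x)))"
  using h
proof (induction r arbitrary: h m)
  case (0 h m)
  show ?case
    using integral_continuous_on_param[of "ball 0 e" 0 1 "\<lambda>x t. t ^ m *\<^sub>R h (t *\<^sub>R x)"]
      continuous_on_ray[OF smooth_on_continuous[OF 0], of m] by simp
next
  case (Suc r h m)
  let ?D = "\<lambda>y. frechet_derivative h (at y)"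
  \<comment> \<open>The total derivative of the integrand in \<open>x\<close>, as a bounded operator.\<close>
  define F where "F x t = t ^ Suc m *\<^sub>R Blinfun (?D (t *\<^sub>R x))" for x t
  have bl: "bounded_linear (?D y)" if "y \<in> ball 0 e" for y
    by (rule has_derivative_bounded_linear[OF smooth_on_has_derivative[OF Suc.prems that]])
  have cont_D: "continuous_on (ball 0 e) (\<lambda>y. Blinfun (?D y))"
  proof (rule continuous_on_blinfun_componentwise)
    fix i :: 'a
    have "continuous_on (ball 0 e) (\<lambda>y. ?D y i)"
      by (intro smooth_on_continuous smooth_on_frechet_derivative Suc.prems)
    then show "continuous_on (ball 0 e) (\<lambda>y. Blinfun (?D y) i)"
      by (rule continuous_on_cong[THEN iffD1, OF refl, rotated])
        (simp add: bounded_linear_Blinfun_apply[OF bl])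
  qed
  have cont_F: "continuous_on (ball 0 e \<times> {0..1}) (\<lambda>(x, t). F x t)"
    using continuous_on_ray[OF cont_D, of "Suc m"] unfolding F_def .
  have F_apply: "F x t v = t ^ Suc m *\<^sub>R ?D (t *\<^sub>R x) v" if "x \<in> ball 0 e" "t \<in> {0..1}" for x t v
    using bounded_linear_Blinfun_apply[OF bl[OF scaleR_in_ball_0[OF that]]]
    by (simp add: F_def scaleR_blinfun.rep_eq)
  have slice: "continuous_on {0..1} (\<lambda>t. G x t)"
    if "continuous_on (ball 0 e \<times> {0..1}) (\<lambda>(x, t). G x t)" "x \<in> ball 0 e"
    for G :: "'a \<Rightarrow> real \<Rightarrow> 'c::topological_space" and x
  proof -
    have "continuous_on {0..1} (Pair x)" by (intro continuous_on_Pair continuous_on_const continuous_on_id)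
    moreover have "Pair x ` {0..1} \<subseteq> ball 0 e \<times> {0..1}" using that(2) by auto
    ultimately show ?thesis using continuous_on_compose2[OF that(1)] by fastforce
  qed
  show ?case
  proof (rule differentiable_upto_SucI[OF open_ball])
    fix x :: 'a assume x: "x \<in> ball 0 e"
    have "((\<lambda>x. integral (cbox 0 1) (\<lambda>t. t ^ m *\<^sub>R h (t *\<^sub>R x))) has_derivative
        integral (cbox 0 1) (F x)) (at x within ball 0 e)"
    proof (rule leibniz_rule[OF _ _ _ x convex_ball])
      fix y :: 'a and t :: real assume y: "y \<in> ball 0 e" and t: "t \<in> cbox 0 (1::real)"
      then have ty: "t *\<^sub>R y \<in> ball 0 e" using scaleR_in_ball_0[of y e t] by simp
      have "((\<lambda>y. t *\<^sub>R y) has_derivative (\<lambda>v. t *\<^sub>R v)) (at y)"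
        by (auto intro!: derivative_eq_intros)
      from diff_chain_at[OF this smooth_on_has_derivative[OF Suc.prems ty]]
      have "((\<lambda>y. h (t *\<^sub>R y)) has_derivative (\<lambda>v. ?D (t *\<^sub>R y) (t *\<^sub>R v))) (at y)"
        by (simp add: o_def)
      then have "((\<lambda>y. t ^ m *\<^sub>R h (t *\<^sub>R y)) has_derivative
          (\<lambda>v. t ^ m *\<^sub>R ?D (t *\<^sub>R y) (t *\<^sub>R v))) (at y)"
        by (rule has_derivative_scaleR_right)
      moreover have "(\<lambda>v. t ^ m *\<^sub>R ?D (t *\<^sub>R y) (t *\<^sub>R v)) = blinfun_apply (F y t)"
        using F_apply[OF y, of t] t linear_scale[OF smooth_on_linear_derivative[OF Suc.prems ty]]
        by (simp add: fun_eq_iff)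
      ultimately show "((\<lambda>y. t ^ m *\<^sub>R h (t *\<^sub>R y)) has_derivative blinfun_apply (F y t))
          (at y within ball 0 e)"
        by (simp add: has_derivative_at_withinI)
    next
      fix y :: 'a assume y: "y \<in> ball 0 e"
      show "(\<lambda>t. t ^ m *\<^sub>R h (t *\<^sub>R y)) integrable_on cbox 0 1"
        using slice[OF continuous_on_ray[OF smooth_on_continuous[OF Suc.prems]] y]
        by (intro integrable_continuous) simp
    qed (use cont_F in simp)
    then have has_deriv: "((\<lambda>x. integral {0..1} (\<lambda>t. t ^ m *\<^sub>R h (t *\<^sub>R x))) has_derivative
        blinfun_apply (integral {0..1} (F x))) (at x)"
      using x by (simp add: at_within_open[OF x open_ball])
    have "blinfun_apply (integral {0..1} (F x)) v =
        integral {0..1} (\<lambda>t. t ^ Suc m *\<^sub>R ?D (t *\<^sub>R x) v)" for v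
    proof -
      have "F x integrable_on {0..1}"
        using slice[OF cont_F x] integrable_continuous_interval by blast
      then have "blinfun_apply (integral {0..1} (F x)) v = integral {0..1} (\<lambda>t. F x t v)"
        by (rule blinfun_apply_integral)
      also have "\<dots> = integral {0..1} (\<lambda>t. t ^ Suc m *\<^sub>R ?D (t *\<^sub>R x) v)"
        by (intro integral_cong F_apply x)
      finally show ?thesis .
    qed
    from has_derivative_eq_rhs[OF has_deriv ext[OF this]]
    show "((\<lambda>x. integral {0..1} (\<lambda>t. t ^ m *\<^sub>R h (t *\<^sub>R x))) has_derivative
        (\<lambda>v. integral {0..1} (\<lambda>t. t ^ Suc m *\<^sub>R ?D (t *\<^sub>R x) v))) (at x)"
      .
  next
    fix v
    show "differentiable_upto r (ball 0 e)
        (\<lambda>x. integral {0..1} (\<lambda>t. t ^ Suc m *\<^sub>R ?D (t *\<^sub>R x) v))"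
      by (intro Suc.IH smooth_on_frechet_derivative Suc.prems)
  qed
qed

text \<open>Integrating the derivative of \<open>f\<close> along the ray from \<open>0\<close> to \<open>x\<close> gives
  \<open>f x = \<Sum>b. \<langle>x, b\<rangle> (\<integral> Df(t x) b dt)\<close>.\<close>

lemma hadamard:
  fixes f :: "'a::euclidean_space \<Rightarrow> real"
  assumes f: "smooth_on (ball 0 e) f" and f0: "f 0 = 0"
  obtains g :: "'a \<Rightarrow> 'a" where
    "smooth_on (ball 0 e) g" "\<And>x. x \<in> ball 0 e \<Longrightarrow> f x = x \<bullet> g x"
proof
  let ?D = "\<lambda>y. frechet_derivative f (at y)"
  let ?G = "\<lambda>b x. integral {0..1} (\<lambda>t. ?D (t *\<^sub>R x) b)"
  show "smooth_on (ball 0 e) (\<lambda>x. \<Sum>b\<in>Basis. ?G b x *\<^sub>R b)"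
  proof (intro smooth_on_sum smooth_on_scaleR smooth_on_const open_ball)
    fix b :: 'a
    show "smooth_on (ball 0 e) (?G b)"
      using differentiable_upto_ray_average[OF smooth_on_frechet_derivative[OF f], of _ 0 b]
      by (simp add: smooth_on_def)
  qed
  show "f x = x \<bullet> (\<Sum>b\<in>Basis. ?G b x *\<^sub>R b)" if x: "x \<in> ball 0 e" for x
  proof -
    have "((\<lambda>t. ?D (t *\<^sub>R x) x) has_integral f (1 *\<^sub>R x) - f (0 *\<^sub>R x)) {0..1}"
    proof (rule fundamental_theorem_of_calculus)
      fix t :: real assume t: "t \<in> {0..1}"
      note d = smooth_on_has_derivative[OF f scaleR_in_ball_0[OF x t]]
      have "((\<lambda>t. t *\<^sub>R x) has_derivative (\<lambda>s. s *\<^sub>R x)) (at t)"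
        by (auto intro!: derivative_eq_intros)
      from diff_chain_at[OF this d]
      have "((\<lambda>t. f (t *\<^sub>R x)) has_derivative (\<lambda>s. s *\<^sub>R ?D (t *\<^sub>R x) x)) (at t)"
        by (simp add: o_def linear_scale[OF has_derivative_linear[OF d]])
      then show "((\<lambda>t. f (t *\<^sub>R x)) has_vector_derivative ?D (t *\<^sub>R x) x) (at t within {0..1})"
        unfolding has_vector_derivative_def by (rule has_derivative_at_withinI)
    qed simp
    then have "f x = integral {0..1} (\<lambda>t. ?D (t *\<^sub>R x) x)"
      using f0 by (simp add: integral_unique)
    also have "\<dots> = integral {0..1} (\<lambda>t. \<Sum>b\<in>Basis. (x \<bullet> b) * ?D (t *\<^sub>R x) b)"
      by (intro integral_cong)
        (use linear_Basis_expansion[OF smooth_on_linear_derivative[OF f scaleR_in_ball_0[OF x]], of _ x]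
          in \<open>simp only: real_scaleR_def\<close>)
    also have "\<dots> = (\<Sum>b\<in>Basis. (x \<bullet> b) * ?G b x)"
    proof (subst integral_sum)
      fix b :: 'a
      have "continuous_on {0..1} (\<lambda>t. ?D (t *\<^sub>R x) b)"
        by (rule continuous_on_compose2[OF smooth_on_continuous[OF smooth_on_frechet_derivative[OF f]]])
          (use scaleR_in_ball_0[OF x] in \<open>auto intro!: continuous_intros\<close>)
      then show "(\<lambda>t. (x \<bullet> b) * ?D (t *\<^sub>R x) b) integrable_on {0..1}"
        by (intro integrable_continuous_interval continuous_intros)
    qed simp_all
    also have "\<dots> = x \<bullet> (\<Sum>b\<in>Basis. ?G b x *\<^sub>R b)"
      by (simp add: inner_sum_right mult.commute)
    finally show ?thesis .
  qed
qed

section \<open>Symmetric multilinear maps\<close>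

lemma fun_sum_apply: "(\<Sum>i\<in>I. f i) x = (\<Sum>i\<in>I. f i x)"
  for f :: "'i \<Rightarrow> 'a \<Rightarrow> 'b::comm_monoid_add"
  by (induction I rule: infinite_finite_induct) (simp_all add: zero_fun_def plus_fun_def)

lemma scaleR_fun_apply: "(c *\<^sub>R f) x = c *\<^sub>R f x"
  by (simp add: scaleR_fun_def)

lemma sym_multilinear_cong:
  "e \<in> sym_multilinear k \<Longrightarrow> (\<And>i. i < k \<Longrightarrow> u i = v i) \<Longrightarrow> e u = e v"
  unfolding sym_multilinear_def by blast

lemma sym_multilinear_linear:
  "e \<in> sym_multilinear k \<Longrightarrow> i < k \<Longrightarrow> linear (\<lambda>w. e (u(i := w)))"
  unfolding sym_multilinear_def by blast

lemma sym_multilinear_permute: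
  "e \<in> sym_multilinear k \<Longrightarrow> \<pi> permutes {..<k} \<Longrightarrow> e (u \<circ> \<pi>) = e u"
  unfolding sym_multilinear_def by blast

lemma sym_multilinearI:
  assumes "\<And>u v. (\<And>i. i < k \<Longrightarrow> u i = v i) \<Longrightarrow> e u = e v"
    and "\<And>u i. i < k \<Longrightarrow> linear (\<lambda>w. e (u(i := w)))"
    and "\<And>\<pi> u. \<pi> permutes {..<k} \<Longrightarrow> e (u \<circ> \<pi>) = e u"
  shows "e \<in> sym_multilinear k"
  using assms unfolding sym_multilinear_def by blast

lemma subspace_sym_multilinear: "subspace (sym_multilinear k)"
proof (rule subspaceI)
  show "0 \<in> sym_multilinear k"
    by (rule sym_multilinearI) (simp_all add: linear_zero)
next
  fix e e' :: "(nat \<Rightarrow> 'a) \<Rightarrow> 'a"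
  assume e: "e \<in> sym_multilinear k" and e': "e' \<in> sym_multilinear k"
  show "e + e' \<in> sym_multilinear k"
  proof (rule sym_multilinearI)
    fix u v :: "nat \<Rightarrow> 'a" assume "\<And>i. i < k \<Longrightarrow> u i = v i"
    then show "(e + e') u = (e + e') v"
      using sym_multilinear_cong[OF e] sym_multilinear_cong[OF e'] unfolding plus_fun_def by metis
  next
    fix u :: "nat \<Rightarrow> 'a" and i assume "i < k"
    then show "linear (\<lambda>w. (e + e') (u(i := w)))"
      using e e' by (simp add: linear_compose_add sym_multilinear_linear)
  next
    fix \<pi> and u :: "nat \<Rightarrow> 'a" assume "\<pi> permutes {..<k}"
    then show "(e + e') (u \<circ> \<pi>) = (e + e') u"
      using e e' by (simp add: sym_multilinear_permute)
  qed
next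
  fix c and e :: "(nat \<Rightarrow> 'a) \<Rightarrow> 'a" assume e: "e \<in> sym_multilinear k"
  show "c *\<^sub>R e \<in> sym_multilinear k"
  proof (rule sym_multilinearI)
    fix u v :: "nat \<Rightarrow> 'a" assume "\<And>i. i < k \<Longrightarrow> u i = v i"
    then show "(c *\<^sub>R e) u = (c *\<^sub>R e) v"
      using sym_multilinear_cong[OF e] unfolding scaleR_fun_apply by metis
  next
    fix u :: "nat \<Rightarrow> 'a" and i assume "i < k"
    then show "linear (\<lambda>w. (c *\<^sub>R e) (u(i := w)))"
      using e by (simp add: scaleR_fun_apply linear_compose_scale_right sym_multilinear_linear)
  next
    fix \<pi> and u :: "nat \<Rightarrow> 'a" assume "\<pi> permutes {..<k}"
    then show "(c *\<^sub>R e) (u \<circ> \<pi>) = (c *\<^sub>R e) u"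
      using e by (simp add: scaleR_fun_apply sym_multilinear_permute)
  qed
qed

abbreviation basis_tuples :: "nat \<Rightarrow> (nat \<Rightarrow> 'v::euclidean_space) set" where
  "basis_tuples k \<equiv> {..<k} \<rightarrow>\<^sub>E Basis"

lemma finite_basis_tuples: "finite (basis_tuples k)"
  by (intro finite_PiE) auto

lemma sum_basis_tuples_Suc:
  fixes F :: "(nat \<Rightarrow> 'v::euclidean_space) \<Rightarrow> 'b::comm_monoid_add"
  shows "sum F (basis_tuples (Suc m)) = (\<Sum>t\<in>basis_tuples m. \<Sum>b\<in>Basis. F (t(m := b)))"
proof -
  have "basis_tuples (Suc m) = (\<lambda>(b, t). t(m := b)) ` (Basis \<times> (basis_tuples m :: (nat \<Rightarrow> 'v) set))"
    using PiE_insert_eq[of m "{..<m}" "\<lambda>_. Basis :: 'v set"] by (simp add: lessThan_Suc)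
  moreover have "inj_on (\<lambda>(b, t). t(m := b)) (Basis \<times> (basis_tuples m :: (nat \<Rightarrow> 'v) set))"
    using inj_combinator[of m "{..<m}" "\<lambda>_. Basis :: 'v set"] by simp
  ultimately have "sum F (basis_tuples (Suc m)) = (\<Sum>(b, t)\<in>Basis \<times> basis_tuples m. F (t(m := b)))"
    by (simp add: sum.reindex case_prod_unfold comp_def)
  also have "\<dots> = (\<Sum>t\<in>basis_tuples m. \<Sum>b\<in>Basis. F (t(m := b)))"
    by (simp add: sum.cartesian_product[symmetric] sum.swap[of _ Basis])
  finally show ?thesis .
qed

text \<open>The first \<open>m\<close> slots are expanded in the basis, one at a time, by induction on \<open>m \<le> k\<close>.\<close>

lemma multilinear_expansion:
  fixes e :: "(nat \<Rightarrow> 'v::euclidean_space) \<Rightarrow> 'v"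
  assumes e: "e \<in> sym_multilinear k"
  shows "e u = (\<Sum>t\<in>basis_tuples k. (\<Prod>j<k. u j \<bullet> t j) *\<^sub>R e t)"
proof -
  have "e u = (\<Sum>t\<in>basis_tuples m. (\<Prod>j<m. u j \<bullet> t j) *\<^sub>R e (\<lambda>j. if j < m then t j else u j))"
    if "m \<le> k" for m
    using that
  proof (induction m)
    case 0
    show ?case by simp
  next
    case (Suc m)
    have slot: "e (\<lambda>j. if j < m then t j else u j) =
        (\<Sum>b\<in>Basis. (u m \<bullet> b) *\<^sub>R e (\<lambda>j. if j < Suc m then (t(m := b)) j else u j))" for t
    proof -
      let ?u = "\<lambda>j. if j < m then t j else u j"
      have "e ?u = e (?u(m := u m))" by (rule arg_cong[of _ _ e]) auto
      also have "\<dots> = (\<Sum>b\<in>Basis. (u m \<bullet> b) *\<^sub>R e (?u(m := b)))"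
        by (rule linear_Basis_expansion[OF sym_multilinear_linear[OF e]]) (use Suc.prems in simp)
      also have "\<dots> = (\<Sum>b\<in>Basis. (u m \<bullet> b) *\<^sub>R e (\<lambda>j. if j < Suc m then (t(m := b)) j else u j))"
        by (intro sum.cong refl arg_cong[of _ _ "\<lambda>w. _ *\<^sub>R e w"]) auto
      finally show ?thesis .
    qed
    have "(\<Prod>j<m. u j \<bullet> (t(m := b)) j) = (\<Prod>j<m. u j \<bullet> t j)" for t b
      by (rule prod.cong) auto
    then show ?case
      using Suc unfolding sum_basis_tuples_Suc
      by (simp add: slot scaleR_sum_right prod.lessThan_Suc del: fun_upd_apply)
        (simp add: mult.commute)
  qed
  from this[of k] show ?thesis
    using sym_multilinear_cong[OF e, of "\<lambda>j. if j < k then _ j else u j"] by simp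
qed

text \<open>The symmetrisation of the multilinear map \<open>u \<mapsto> (\<Prod>i. \<langle>u\<^sub>i, g\<^sub>i\<rangle>) y\<close>, without the factor \<open>1/k!\<close>. It
  provides both the basis of the fibre and the lifts of vector fields.\<close>

definition sym_tensor ::
  "nat \<Rightarrow> (nat \<Rightarrow> 'v::euclidean_space) \<Rightarrow> 'v \<Rightarrow> (nat \<Rightarrow> 'v) \<Rightarrow> 'v" where
  "sym_tensor k g y u = (\<Sum>\<pi> | \<pi> permutes {..<k}. (\<Prod>i<k. u (\<pi> i) \<bullet> g i) *\<^sub>R y)"

lemma sym_tensor_in: "sym_tensor k g y \<in> sym_multilinear k"
proof (rule sym_multilinearI)
  fix u v :: "nat \<Rightarrow> 'a" assume eq: "\<And>i. i < k \<Longrightarrow> u i = v i"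
  have "(\<Prod>i<k. u (\<pi> i) \<bullet> g i) = (\<Prod>i<k. v (\<pi> i) \<bullet> g i)" if "\<pi> permutes {..<k}" for \<pi>
    using permutes_in_image[OF that] eq by (intro prod.cong) auto
  then show "sym_tensor k g y u = sym_tensor k g y v"
    unfolding sym_tensor_def by (intro sum.cong) auto
next
  fix u :: "nat \<Rightarrow> 'a" and i assume i: "i < k"
  have "linear (\<lambda>w. (\<Prod>j<k. (u(i := w)) (\<pi> j) \<bullet> g j) *\<^sub>R y)" if \<pi>: "\<pi> permutes {..<k}" for \<pi>
  proof -
    obtain j where j: "j < k" "\<pi> j = i"
      using permutes_image[OF \<pi>] i by (metis imageE lessThan_iff)
    have other: "\<pi> l \<noteq> i" if "l \<noteq> j" for l
      using permutes_inj[OF \<pi>] j that by (metis injD)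
    have "(\<Prod>l<k. (u(i := w)) (\<pi> l) \<bullet> g l) = (w \<bullet> g j) * (\<Prod>l\<in>{..<k} - {j}. u (\<pi> l) \<bullet> g l)" for w
    proof -
      have "(\<Prod>l\<in>{..<k} - {j}. (u(i := w)) (\<pi> l) \<bullet> g l) = (\<Prod>l\<in>{..<k} - {j}. u (\<pi> l) \<bullet> g l)"
        by (rule prod.cong) (simp_all add: other)
      then show ?thesis using j by (simp add: prod.remove[of "{..<k}" j])
    qed
    then show ?thesis
      by (simp only:) (rule linearI; simp add: inner_add_left algebra_simps)
  qed
  then show "linear (\<lambda>w. sym_tensor k g y (u(i := w)))"
    unfolding sym_tensor_def by (intro linear_compose_sum) auto
next
  fix \<pi> and u :: "nat \<Rightarrow> 'a" assume "\<pi> permutes {..<k}"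
  from setum_permutations_compose_left[OF this, of "\<lambda>p. (\<Prod>i<k. u (p i) \<bullet> g i) *\<^sub>R y"]
  show "sym_tensor k g y (u \<circ> \<pi>) = sym_tensor k g y u"
    unfolding sym_tensor_def by (simp add: comp_def)
qed

lemma sym_tensor_diagonal:
  "sym_tensor k g y (\<lambda>_. x) = (fact k * (\<Prod>i<k. x \<bullet> g i)) *\<^sub>R y"
  by (simp add: sym_tensor_def sum_constant_scaleR card_permutations[OF card_lessThan])

lemma smooth_on_sym_tensor:
  assumes "open U" "\<And>i. i < k \<Longrightarrow> smooth_on U (g i)" "smooth_on U y"
  shows "smooth_on U (\<lambda>x. sym_tensor k (\<lambda>i. g i x) (y x) u)"
  unfolding sym_tensor_def
  by (intro smooth_on_sum smooth_on_scaleR smooth_on_prod smooth_on_inner smooth_on_const assms) auto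

text \<open>Average \<open>multilinear_expansion\<close> over all permutations of the arguments.\<close>

lemma sym_multilinear_sym_tensor_expansion:
  fixes e :: "(nat \<Rightarrow> 'v::euclidean_space) \<Rightarrow> 'v"
  assumes e: "e \<in> sym_multilinear k"
  shows "e = (\<Sum>t\<in>basis_tuples k. \<Sum>b\<in>Basis. ((e t \<bullet> b) / fact k) *\<^sub>R sym_tensor k t b)"
proof
  fix u :: "nat \<Rightarrow> 'v"
  have "(\<Sum>\<pi> | \<pi> permutes {..<k}. e (u \<circ> \<pi>)) = (\<Sum>\<pi> | \<pi> permutes {..<k}. e u)"
    by (rule sum.cong) (use sym_multilinear_permute[OF e] in auto)
  then have "fact k *\<^sub>R e u = (\<Sum>\<pi> | \<pi> permutes {..<k}. e (u \<circ> \<pi>))"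
    by (simp add: sum_constant_scaleR card_permutations[OF card_lessThan])
  also have "\<dots> = (\<Sum>\<pi> | \<pi> permutes {..<k}. \<Sum>t\<in>basis_tuples k. (\<Prod>i<k. u (\<pi> i) \<bullet> t i) *\<^sub>R e t)"
    by (subst multilinear_expansion[OF e]) simp
  also have "\<dots> = (\<Sum>t\<in>basis_tuples k. sym_tensor k t (e t) u)"
    unfolding sym_tensor_def by (rule sum.swap)
  also have "\<dots> = (\<Sum>t\<in>basis_tuples k. \<Sum>b\<in>Basis. (e t \<bullet> b) *\<^sub>R sym_tensor k t b u)"
  proof (rule sum.cong[OF refl])
    fix t
    have "linear (\<lambda>y. sym_tensor k t y u)"
      unfolding sym_tensor_def by (intro linear_compose_sum ballI linear_scale_self)
    then show "sym_tensor k t (e t) u = (\<Sum>b\<in>Basis. (e t \<bullet> b) *\<^sub>R sym_tensor k t b u)"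
      by (rule linear_Basis_expansion)
  qed
  finally have "(1 / fact k) *\<^sub>R fact k *\<^sub>R e u =
      (1 / fact k) *\<^sub>R (\<Sum>t\<in>basis_tuples k. \<Sum>b\<in>Basis. (e t \<bullet> b) *\<^sub>R sym_tensor k t b u)"
    by (rule arg_cong)
  then show "e u = (\<Sum>t\<in>basis_tuples k. \<Sum>b\<in>Basis. ((e t \<bullet> b) / fact k) *\<^sub>R sym_tensor k t b) u"
    by (simp add: fun_sum_apply scaleR_fun_apply scaleR_sum_right)
qed

section \<open>The rank of the bundle\<close>

text \<open>A family with a dual family of functionals (up to nonzero factors) is injective, hence can be counted by
  its index set, and linearly independent.\<close>

lemma independent_dual_family:
  fixes v :: "'i \<Rightarrow> 'a::real_vector" and ev :: "'i \<Rightarrow> 'a \<Rightarrow> real"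
  assumes "finite I" and lin: "\<And>i. i \<in> I \<Longrightarrow> linear (ev i)"
    and diag: "\<And>i. i \<in> I \<Longrightarrow> ev i (v i) \<noteq> 0"
    and off: "\<And>i j. i \<in> I \<Longrightarrow> j \<in> I \<Longrightarrow> i \<noteq> j \<Longrightarrow> ev i (v j) = 0"
  shows "inj_on v I" "independent (v ` I)"
proof -
  show inj: "inj_on v I" using diag off by (metis inj_onI)
  show "independent (v ` I)"
  proof (rule independent_if_scalars_zero)
    fix f w assume sum0: "(\<Sum>x\<in>v ` I. f x *\<^sub>R x) = 0" and "w \<in> v ` I"
    then obtain i where i: "i \<in> I" "w = v i" by blast
    interpret linear "ev i" by (rule lin[OF i(1)])
    have "0 = ev i (\<Sum>j\<in>I. f (v j) *\<^sub>R v j)" using sum0 inj by (simp add: sum.reindex zero)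
    also have "\<dots> = (\<Sum>j\<in>I. f (v j) * ev i (v j))" by (simp add: sum scale)
    also have "\<dots> = (\<Sum>j\<in>I. if j = i then f (v j) * ev i (v j) else 0)"
      by (rule sum.cong) (use off i in auto)
    also have "\<dots> = f w * ev i w" using i \<open>finite I\<close> by simp
    finally show "f w = 0" using diag i by simp
  qed (use \<open>finite I\<close> in simp)
qed

text \<open>The orbit of a tuple under permutation of its entries is determined by the multiset of these entries.\<close>

definition tuple_mset :: "nat \<Rightarrow> (nat \<Rightarrow> 'v) \<Rightarrow> 'v multiset" where
  "tuple_mset k t = image_mset t (mset_set {..<k})"

lemma tuple_mset_eqD:
  assumes "tuple_mset k t = tuple_mset k t'"
  obtains \<pi> where "\<pi> permutes {..<k}" "\<And>i. i < k \<Longrightarrow> t i = t' (\<pi> i)"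
proof -
  obtain \<pi> where "\<pi> permutes {..<k}" "\<forall>i\<in>{..<k}. t i = t' (\<pi> i)"
    by (rule image_mset_eq_implies_permutes[OF _ assms[unfolded tuple_mset_def]]) auto
  then show thesis using that by simp
qed

lemma tuple_mset_permute: "\<pi> permutes {..<k} \<Longrightarrow> tuple_mset k (t \<circ> \<pi>) = tuple_mset k t"
  by (metis tuple_mset_def image_mset.compositionality permutes_image_mset)

lemma tuple_mset_cong: "(\<And>i. i < k \<Longrightarrow> t i = t' i) \<Longrightarrow> tuple_mset k t = tuple_mset k t'"
  unfolding tuple_mset_def by (rule image_mset_cong) auto

lemma tuple_mset_basis_tuples: "tuple_mset k ` basis_tuples k = multisets_of_size Basis k"
proof (intro equalityI subsetI)
  fix M :: "'a multiset" assume M: "M \<in> multisets_of_size Basis k"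
  obtain xs where xs: "mset xs = M" by (rule ex_mset[THEN exE])
  let ?t = "restrict (nth xs) {..<k}"
  have len: "length xs = k" and sub: "set xs \<subseteq> Basis"
    using M xs by (auto simp: multisets_of_size_def)
  have "tuple_mset k ?t = image_mset (nth xs) (mset_set {..<k})"
    by (subst tuple_mset_cong[of k _ "nth xs"]) (simp_all add: tuple_mset_def)
  also have "\<dots> = mset (map (nth xs) [0..<k])"
    by (simp add: mset_set_upto_eq_mset_upto)
  also have "map (nth xs) [0..<k] = xs" using len map_nth by blast
  finally have "tuple_mset k ?t = M" using xs by (simp only:)
  moreover have "?t \<in> basis_tuples k" using len sub nth_mem[of _ xs] by auto
  ultimately show "M \<in> tuple_mset k ` basis_tuples k" by blast
next
  fix M :: "'a multiset" assume "M \<in> tuple_mset k ` basis_tuples k"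
  then obtain t where t: "t \<in> basis_tuples k" "M = tuple_mset k t" by blast
  have "t ` {..<k} \<subseteq> Basis" using PiE_mem[OF t(1)] by blast
  then show "M \<in> multisets_of_size Basis k"
    by (simp add: t(2) tuple_mset_def multisets_of_size_def)
qed

lemma sym_tensor_tuple_mset:
  assumes "tuple_mset k t = tuple_mset k t'"
  shows "sym_tensor k t y = sym_tensor k t' y"
proof
  fix u :: "nat \<Rightarrow> 'a"
  obtain \<sigma> where \<sigma>: "\<sigma> permutes {..<k}" "\<And>i. i < k \<Longrightarrow> t i = t' (\<sigma> i)"
    by (rule tuple_mset_eqD[OF assms]) blast
  have "(\<Prod>i<k. u (\<pi> (\<sigma> i)) \<bullet> t i) = (\<Prod>i<k. u (\<pi> i) \<bullet> t' i)" for \<pi>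
    using prod.permute[OF \<sigma>(1), of "\<lambda>i. u (\<pi> i) \<bullet> t' i"] \<sigma>(2) by (simp add: comp_def)
  then have "sym_tensor k t' y u = (\<Sum>\<pi> | \<pi> permutes {..<k}. (\<Prod>i<k. u ((\<pi> \<circ> \<sigma>) i) \<bullet> t i) *\<^sub>R y)"
    by (simp add: sym_tensor_def)
  also have "\<dots> = sym_tensor k t y u"
    unfolding sym_tensor_def
    by (rule sum_permutations_compose_right[OF \<sigma>(1), symmetric])
  finally show "sym_tensor k t y u = sym_tensor k t' y u" ..
qed

text \<open>In an orthonormal basis a product of inner products of basis vectors is \<open>1\<close> if all pairs agree and \<open>0\<close>
  otherwise. So the value counts the permutations that carry one tuple to the other, and vanishes if the tuples have
  different multisets of entries.\<close>

lemma sym_tensor_basis_tuple: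
  assumes t: "t \<in> basis_tuples k" and t': "t' \<in> basis_tuples k"
  shows "sym_tensor k t y t' = real (card {\<pi>. \<pi> permutes {..<k} \<and> (\<forall>i<k. t' (\<pi> i) = t i)}) *\<^sub>R y"
proof -
  have "(\<Prod>i<k. t' (\<pi> i) \<bullet> t i) = (if \<forall>i<k. t' (\<pi> i) = t i then 1 else 0)"
    if "\<pi> permutes {..<k}" for \<pi>
  proof -
    have "t' (\<pi> i) \<bullet> t i = (if t' (\<pi> i) = t i then 1 else 0)" if "i < k" for i
      using t t' that permutes_in_image[OF \<open>\<pi> permutes {..<k}\<close>, of i]
      by (intro inner_Basis) (auto simp: PiE_iff)
    then show ?thesis by (auto intro!: prod_zero)
  qed
  then have "sym_tensor k t y t' = (\<Sum>\<pi> | \<pi> permutes {..<k}. if \<forall>i<k. t' (\<pi> i) = t i then y else 0)"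
    unfolding sym_tensor_def by (intro sum.cong) auto
  also have "\<dots> = (\<Sum>\<pi> | \<pi> permutes {..<k} \<and> (\<forall>i<k. t' (\<pi> i) = t i). y)"
    by (simp add: sum.If_cases finite_permutations Collect_conj_eq[symmetric])
  finally show ?thesis by (simp add: sum_constant_scaleR)
qed

lemma sym_multilinear_basis:
  obtains B :: "((nat \<Rightarrow> 'v::euclidean_space) \<Rightarrow> 'v) set" where
    "finite B" "independent B" "span B = sym_multilinear k"
    "card B = DIM('v) * ((DIM('v) + k - 1) choose k)"
proof -
  \<comment> \<open>One basis tuple for each multiset of size \<open>k\<close>; evaluation at these tuples gives the dual family.\<close>
  define rep :: "'v multiset \<Rightarrow> nat \<Rightarrow> 'v" where
    "rep M = (SOME t. t \<in> basis_tuples k \<and> tuple_mset k t = M)" for M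
  have rep: "rep M \<in> basis_tuples k" "tuple_mset k (rep M) = M" if "M \<in> multisets_of_size Basis k" for M
    using someI_ex[of "\<lambda>t. t \<in> basis_tuples k \<and> tuple_mset k t = M"] that
    unfolding rep_def tuple_mset_basis_tuples[symmetric] by blast+
  define I where "I = multisets_of_size (Basis :: 'v set) k \<times> (Basis :: 'v set)"
  define v where "v = (\<lambda>(M, b :: 'v). sym_tensor k (rep M) b)"
  define ev where "ev = (\<lambda>(M, b :: 'v). \<lambda>e :: (nat \<Rightarrow> 'v) \<Rightarrow> 'v. e (rep M) \<bullet> b)"
  have fin_M: "finite (multisets_of_size (Basis :: 'v set) k)"
    unfolding tuple_mset_basis_tuples[symmetric] by (intro finite_imageI finite_basis_tuples)
  then have fin: "finite I" by (simp add: I_def)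
  have lin: "linear (ev i)" for i
    by (rule linearI)
      (simp_all add: ev_def case_prod_beta plus_fun_def scaleR_fun_apply inner_add_left)
  have diag: "ev i (v i) \<noteq> 0" if i_I: "i \<in> I" for i
  proof -
    obtain M b where i: "i = (M, b)" and M: "M \<in> multisets_of_size Basis k" and b: "b \<in> Basis"
      using i_I by (auto simp: I_def)
    let ?P = "{\<pi>. \<pi> permutes {..<k} \<and> (\<forall>j<k. rep M (\<pi> j) = rep M j)}"
    \<comment> \<open>The identity carries a tuple to itself, so the diagonal value is positive.\<close>
    have "id \<in> ?P" by (simp add: permutes_id)
    moreover have "finite ?P" by (rule finite_subset[OF _ finite_permutations[of "{..<k}"]]) auto
    ultimately have "0 < card ?P" unfolding card_gt_0_iff by blast
    then show ?thesis
      using b unfolding i ev_def v_def prod.case sym_tensor_basis_tuple[OF rep(1)[OF M] rep(1)[OF M]]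
      by simp
  qed
  have off: "ev i (v j) = 0" if ij: "i \<in> I" "j \<in> I" "i \<noteq> j" for i j
  proof -
    obtain M b M' b' where i: "i = (M, b)" and j: "j = (M', b')"
      and M: "M \<in> multisets_of_size Basis k" "M' \<in> multisets_of_size Basis k"
      and b: "b \<in> Basis" "b' \<in> Basis"
      using ij by (auto simp: I_def)
    have none: "{\<pi>. \<pi> permutes {..<k} \<and> (\<forall>l<k. rep M (\<pi> l) = rep M' l)} = {}" if "M \<noteq> M'"
    proof -
      have False if \<pi>: "\<pi> permutes {..<k}" "\<forall>l<k. rep M (\<pi> l) = rep M' l" for \<pi>
      proof -
        have "tuple_mset k (rep M') = tuple_mset k (rep M \<circ> \<pi>)"
          by (rule tuple_mset_cong) (use \<pi>(2) in simp)
        then show False using rep(2) M tuple_mset_permute[OF \<pi>(1)] \<open>M \<noteq> M'\<close> by metis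
      qed
      then show ?thesis by blast
    qed
    show ?thesis
      using b ij(3)
      unfolding i j ev_def v_def prod.case sym_tensor_basis_tuple[OF rep(1)[OF M(2)] rep(1)[OF M(1)]]
      by (cases "M = M'") (simp_all add: none inner_not_same_Basis)
  qed
  note dual = independent_dual_family[where I = I and v = v and ev = ev, OF fin lin diag off]
  have "e \<in> span (v ` I)" if e: "e \<in> sym_multilinear k" for e
  proof -
    have "sym_tensor k t b \<in> v ` I" if t: "t \<in> basis_tuples k" and b: "b \<in> Basis" for t b
    proof -
      have M: "tuple_mset k t \<in> multisets_of_size Basis k" using t tuple_mset_basis_tuples by blast
      have "sym_tensor k t b = v (tuple_mset k t, b)"
        unfolding v_def prod.case by (rule sym_tensor_tuple_mset) (simp add: rep(2)[OF M])
      then show ?thesis using M b by (auto simp: I_def)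
    qed
    then have "(\<Sum>t\<in>basis_tuples k. \<Sum>b\<in>Basis. ((e t \<bullet> b) / fact k) *\<^sub>R sym_tensor k t b) \<in> span (v ` I)"
      by (intro span_sum span_scale span_base)
    then show ?thesis using sym_multilinear_sym_tensor_expansion[OF e] by simp
  qed
  moreover have "v ` I \<subseteq> sym_multilinear k"
    by (auto simp: v_def sym_tensor_in)
  ultimately have "span (v ` I) = sym_multilinear k"
    using span_minimal[OF _ subspace_sym_multilinear] by blast
  moreover have "card (v ` I) = DIM('v) * ((DIM('v) + k - 1) choose k)"
    using card_image[OF dual(1)] card_multisets_of_size[of "Basis :: 'v set" k]
    by (simp add: I_def card_cartesian_product)
  ultimately show thesis using that[of "v ` I"] fin dual(2) by blast
qed

section \<open>Smooth sections and their derivatives\<close>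

text \<open>Evaluation at \<open>u\<close> followed by a coordinate is a linear functional on the ambient function space, one
  of those by which smoothness of sections is tested.\<close>

lemma smooth_on_section_apply:
  fixes a :: "'v::euclidean_space \<Rightarrow> (nat \<Rightarrow> 'v) \<Rightarrow> 'v"
  assumes "open U" "a \<in> sections U E"
  shows "smooth_on U (\<lambda>x. a x u)"
proof (rule smooth_on_componentwise[OF assms(1)])
  fix b :: 'v
  have "linear (\<lambda>e :: (nat \<Rightarrow> 'v) \<Rightarrow> 'v. e u \<bullet> b)"
    by (rule linearI) (simp_all add: plus_fun_def scaleR_fun_apply inner_add_left)
  then show "smooth_on U (\<lambda>x. a x u \<bullet> b)"
    using assms(2) unfolding sections_def by blast
qed

text \<open>Conversely, pointwise evaluations suffice: \<open>a x\<close> is a combination of fixed elements \<open>sym_tensor k t b\<close>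
  whose coefficients are evaluations of \<open>a x\<close>, and an arbitrary linear functional passes through this finite sum.\<close>

lemma sections_symI:
  fixes a :: "'v::euclidean_space \<Rightarrow> (nat \<Rightarrow> 'v) \<Rightarrow> 'v"
  assumes "open U" "a \<in> extensional U" and S: "\<And>x. x \<in> U \<Longrightarrow> a x \<in> sym_multilinear k"
    and smooth: "\<And>u. smooth_on U (\<lambda>x. a x u)"
  shows "a \<in> sections U (sym_multilinear k)"
proof -
  have "smooth_on U (\<lambda>x. \<phi> (a x))" if "linear \<phi>" for \<phi> :: "((nat \<Rightarrow> 'v) \<Rightarrow> 'v) \<Rightarrow> real"
  proof -
    interpret linear \<phi> by fact
    have "smooth_on U (\<lambda>x. \<Sum>t\<in>basis_tuples k. \<Sum>b\<in>Basis. ((a x t \<bullet> b) * inverse (fact k)) * \<phi> (sym_tensor k t b))"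
      by (intro smooth_on_sum smooth_on_mult smooth_on_inner smooth_on_const smooth assms(1))
    moreover have "\<phi> (a x) =
        (\<Sum>t\<in>basis_tuples k. \<Sum>b\<in>Basis. ((a x t \<bullet> b) * inverse (fact k)) * \<phi> (sym_tensor k t b))"
      if "x \<in> U" for x
      by (subst sym_multilinear_sym_tensor_expansion[OF S[OF that]])
        (simp add: sum scale divide_inverse)
    ultimately show ?thesis using smooth_on_cong[OF assms(1)] by (metis (no_types, lifting))
  qed
  then show ?thesis using assms(2) S by (auto simp: sections_def PiE_iff)
qed

lemma sections_mem: "a \<in> sections U E \<Longrightarrow> x \<in> U \<Longrightarrow> a x \<in> E"
  by (auto simp: sections_def)

lemma smooth_on_section_eval:
  fixes a :: "'v::euclidean_space \<Rightarrow> (nat \<Rightarrow> 'v) \<Rightarrow> 'v"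
  assumes "open U" and a: "a \<in> sections U (sym_multilinear k)"
    and w: "\<And>j. j < k \<Longrightarrow> smooth_on U (\<lambda>x. w x j)"
  shows "smooth_on U (\<lambda>x. a x (w x))"
proof -
  have "smooth_on U (\<lambda>x. \<Sum>t\<in>basis_tuples k. (\<Prod>j<k. w x j \<bullet> t j) *\<^sub>R a x t)"
    by (intro smooth_on_sum smooth_on_scaleR smooth_on_prod smooth_on_inner smooth_on_const
        smooth_on_section_apply[OF _ a] w assms(1)) auto
  moreover have "a x (w x) = (\<Sum>t\<in>basis_tuples k. (\<Prod>j<k. w x j \<bullet> t j) *\<^sub>R a x t)" if "x \<in> U" for x
    by (rule multilinear_expansion[OF sections_mem[OF a that]])
  ultimately show ?thesis using smooth_on_cong[OF assms(1)] by (metis (no_types, lifting))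
qed

lemma smooth_on_fun_upd:
  "smooth_on U g \<Longrightarrow> smooth_on U (\<lambda>x. u x j) \<Longrightarrow> smooth_on U (\<lambda>x. ((u x)(i := g x)) j)"
  by (cases "j = i") auto

text \<open>The product rule for evaluating a varying multilinear map at varying arguments. It is reduced to the
  product rule for sums and products by the expansion over basis tuples, and the resulting sums are collapsed again by
  the same expansion.\<close>

lemma has_derivative_eval:
  fixes a :: "'v::euclidean_space \<Rightarrow> (nat \<Rightarrow> 'v) \<Rightarrow> 'v"
  assumes a: "\<And>y. a y \<in> sym_multilinear k" and a': "\<And>v. (\<lambda>u. a' u v) \<in> sym_multilinear k"
    and da: "\<And>u. ((\<lambda>y. a y u) has_derivative a' u) (at x)"
    and dw: "\<And>j. j < k \<Longrightarrow> ((\<lambda>y. w y j) has_derivative w' j) (at x)"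
  shows "((\<lambda>y. a y (w y)) has_derivative
    (\<lambda>v. a' (w x) v + (\<Sum>i<k. a x ((w x)(i := w' i v))))) (at x)"
proof -
  have slot: "(\<Prod>j<k. ((w x)(i := z)) j \<bullet> t j) = (z \<bullet> t i) * (\<Prod>j\<in>{..<k} - {i}. w x j \<bullet> t j)"
    if "i < k" for i z t
    using that by (simp add: prod.remove[of "{..<k}" i])
  have "((\<lambda>y. \<Sum>t\<in>basis_tuples k. (\<Prod>j<k. w y j \<bullet> t j) *\<^sub>R a y t) has_derivative
    (\<lambda>v. \<Sum>t\<in>basis_tuples k. (\<Prod>j<k. w x j \<bullet> t j) *\<^sub>R a' t v +
      (\<Sum>i<k. (w' i v \<bullet> t i) * (\<Prod>j\<in>{..<k} - {i}. w x j \<bullet> t j)) *\<^sub>R a x t)) (at x)"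
    by (intro has_derivative_sum has_derivative_scaleR has_derivative_prod has_derivative_inner_left da dw)
      auto
  moreover have "(\<Sum>t\<in>basis_tuples k. (\<Prod>j<k. w x j \<bullet> t j) *\<^sub>R a' t v +
      (\<Sum>i<k. (w' i v \<bullet> t i) * (\<Prod>j\<in>{..<k} - {i}. w x j \<bullet> t j)) *\<^sub>R a x t) =
    a' (w x) v + (\<Sum>i<k. a x ((w x)(i := w' i v)))" for v
  proof -
    have "(\<Sum>i<k. a x ((w x)(i := w' i v))) =
        (\<Sum>i<k. \<Sum>t\<in>basis_tuples k. ((w' i v \<bullet> t i) * (\<Prod>j\<in>{..<k} - {i}. w x j \<bullet> t j)) *\<^sub>R a x t)"
    proof (rule sum.cong[OF refl])
      fix i assume "i \<in> {..<k}"
      then show "a x ((w x)(i := w' i v)) =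
          (\<Sum>t\<in>basis_tuples k. ((w' i v \<bullet> t i) * (\<Prod>j\<in>{..<k} - {i}. w x j \<bullet> t j)) *\<^sub>R a x t)"
        using multilinear_expansion[OF a, of x "(w x)(i := w' i v)"] slot[of i] by simp
    qed
    also have "\<dots> = (\<Sum>t\<in>basis_tuples k. (\<Sum>i<k. (w' i v \<bullet> t i) * (\<Prod>j\<in>{..<k} - {i}. w x j \<bullet> t j)) *\<^sub>R a x t)"
      by (subst sum.swap) (simp add: scaleR_sum_left)
    finally show ?thesis
      using multilinear_expansion[OF a', of "w x" v] by (simp add: sum.distrib)
  qed
  moreover have "(\<lambda>y. a y (w y)) = (\<lambda>y. \<Sum>t\<in>basis_tuples k. (\<Prod>j<k. w y j \<bullet> t j) *\<^sub>R a y t)"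
    by (rule ext) (rule multilinear_expansion[OF a])
  ultimately show ?thesis by simp
qed

text \<open>The derivative of a family of symmetric multilinear maps satisfies the same linear identities, by
  uniqueness of derivatives.\<close>

lemma frechet_derivative_family_in:
  fixes a :: "'v::euclidean_space \<Rightarrow> (nat \<Rightarrow> 'v) \<Rightarrow> 'v"
  assumes a: "\<And>y. a y \<in> sym_multilinear k"
    and da: "\<And>u. ((\<lambda>y. a y u) has_derivative a' u) (at x)"
  shows "(\<lambda>u. a' u v) \<in> sym_multilinear k"
proof (rule sym_multilinearI)
  fix u u' :: "nat \<Rightarrow> 'v" assume "\<And>i. i < k \<Longrightarrow> u i = u' i"
  then have "(\<lambda>y. a y u) = (\<lambda>y. a y u')" using sym_multilinear_cong[OF a] by blast
  then show "a' u v = a' u' v" using da[of u] da[of u'] has_derivative_unique by metis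
next
  fix u :: "nat \<Rightarrow> 'v" and i assume i: "i < k"
  note lin = sym_multilinear_linear[OF a i, of _ u]
  show "linear (\<lambda>w. a' (u(i := w)) v)"
  proof (rule linearI)
    fix w z
    have "(\<lambda>y. a y (u(i := w + z))) = (\<lambda>y. a y (u(i := w)) + a y (u(i := z)))"
      by (rule ext) (rule linear_add[OF lin])
    then have "((\<lambda>y. a y (u(i := w + z))) has_derivative (\<lambda>v. a' (u(i := w)) v + a' (u(i := z)) v)) (at x)"
      using has_derivative_add[OF da[of "u(i := w)"] da[of "u(i := z)"]] by simp
    from has_derivative_unique[OF da this]
    show "a' (u(i := w + z)) v = a' (u(i := w)) v + a' (u(i := z)) v" by simp
  next
    fix r w
    have "(\<lambda>y. a y (u(i := r *\<^sub>R w))) = (\<lambda>y. r *\<^sub>R a y (u(i := w)))"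
      by (rule ext) (rule linear_scale[OF lin])
    then have "((\<lambda>y. a y (u(i := r *\<^sub>R w))) has_derivative (\<lambda>v. r *\<^sub>R a' (u(i := w)) v)) (at x)"
      using has_derivative_scaleR_right[OF da[of "u(i := w)"]] by simp
    from has_derivative_unique[OF da this]
    show "a' (u(i := r *\<^sub>R w)) v = r *\<^sub>R a' (u(i := w)) v" by simp
  qed
next
  fix \<pi> and u :: "nat \<Rightarrow> 'v" assume "\<pi> permutes {..<k}"
  then have "(\<lambda>y. a y (u \<circ> \<pi>)) = (\<lambda>y. a y u)" using sym_multilinear_permute[OF a] by blast
  then show "a' (u \<circ> \<pi>) v = a' u v" using da[of u] da[of "u \<circ> \<pi>"] has_derivative_unique by metis
qed

abbreviation global_sections :: "nat \<Rightarrow> ('v::euclidean_space \<Rightarrow> (nat \<Rightarrow> 'v) \<Rightarrow> 'v) set" where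
  "global_sections k \<equiv> sections UNIV (sym_multilinear k)"

abbreviation anchor_field :: "('v \<Rightarrow> (nat \<Rightarrow> 'v) \<Rightarrow> 'v) \<Rightarrow> 'v \<Rightarrow> 'v" where
  "anchor_field a \<equiv> (\<lambda>y. anchor y (a y))"

text \<open>The covariant derivatives of sections and of endomorphism fields for the flat connection, and the
  derivation action of endomorphism fields on sections. In these terms
  \<open>a \<triangleright> b = D\<^bsub>\<rho>(a)\<^esub> b + \<Lambda>\<^sub>a b\<close> (lemma \<open>tri_eq\<close>).\<close>

definition sec_deriv ::
  "('v \<Rightarrow> 'v) \<Rightarrow> ('v::euclidean_space \<Rightarrow> (nat \<Rightarrow> 'v) \<Rightarrow> 'v) \<Rightarrow> 'v \<Rightarrow> (nat \<Rightarrow> 'v) \<Rightarrow> 'v" where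
  "sec_deriv X c = (\<lambda>x u. deriv_along X (\<lambda>y. c y u) x)"

definition endo_deriv :: "('v \<Rightarrow> 'v) \<Rightarrow> ('v::euclidean_space \<Rightarrow> 'v \<Rightarrow> 'v) \<Rightarrow> 'v \<Rightarrow> 'v \<Rightarrow> 'v" where
  "endo_deriv X T = (\<lambda>x u. deriv_along X (\<lambda>y. T y u) x)"

definition endo_act ::
  "nat \<Rightarrow> ('v \<Rightarrow> 'v \<Rightarrow> 'v) \<Rightarrow> ('v::euclidean_space \<Rightarrow> (nat \<Rightarrow> 'v) \<Rightarrow> 'v) \<Rightarrow> 'v \<Rightarrow> (nat \<Rightarrow> 'v) \<Rightarrow> 'v" where
  "endo_act k T c = (\<lambda>x u. \<Sum>i<k. c x (u(i := T x (u i))))"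

definition endo_fields :: "('v::euclidean_space \<Rightarrow> 'v \<Rightarrow> 'v) set" where
  "endo_fields = {T. (\<forall>x. linear (T x)) \<and> (\<forall>u. smooth_on UNIV (\<lambda>x. T x u))}"

lemma tri_eq: "tri k a b = sec_deriv (anchor_field a) b + endo_act k (Lam k a) b"
  by (simp add: tri_def sec_deriv_def endo_act_def plus_fun_def)

lemma global_sections_mem: "a \<in> global_sections k \<Longrightarrow> a x \<in> sym_multilinear k"
  by (rule sections_mem) auto

lemma global_sections_smooth: "a \<in> global_sections k \<Longrightarrow> smooth_on UNIV (\<lambda>x. a x u)"
  by (rule smooth_on_section_apply[OF open_UNIV])

lemma global_sectionsI:
  "(\<And>x. a x \<in> sym_multilinear k) \<Longrightarrow> (\<And>u. smooth_on UNIV (\<lambda>x. a x u)) \<Longrightarrow> a \<in> global_sections k"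
  by (rule sections_symI) auto

lemma global_sections_slot_linear:
  "a \<in> global_sections k \<Longrightarrow> i < k \<Longrightarrow> linear (\<lambda>w. a x (u(i := w)))"
  by (rule sym_multilinear_linear[OF global_sections_mem])

lemma subspace_global_sections: "subspace (global_sections k)"
proof (rule subspaceI)
  show "0 \<in> global_sections k"
    using subspace_0[OF subspace_sym_multilinear]
    by (intro global_sectionsI) (simp_all add: zero_fun_def smooth_on_const)
next
  fix a b :: "'a \<Rightarrow> (nat \<Rightarrow> 'a) \<Rightarrow> 'a"
  assume "a \<in> global_sections k" "b \<in> global_sections k"
  then show "a + b \<in> global_sections k"
    by (intro global_sectionsI)
      (simp_all add: global_sections_mem global_sections_smooth smooth_on_add
        subspace_add[OF subspace_sym_multilinear])
next
  fix c and a :: "'a \<Rightarrow> (nat \<Rightarrow> 'a) \<Rightarrow> 'a"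
  assume "a \<in> global_sections k"
  then show "c *\<^sub>R a \<in> global_sections k"
    by (intro global_sectionsI)
      (simp_all add: scaleR_fun_apply global_sections_mem global_sections_smooth smooth_on_scale_const
        subspace_scale[OF subspace_sym_multilinear])
qed

lemma deriv_along_section_eval:
  assumes c: "c \<in> global_sections k" and w: "\<And>j. j < k \<Longrightarrow> smooth_on UNIV (\<lambda>y. w y j)"
  shows "deriv_along X (\<lambda>y. c y (w y)) x =
    sec_deriv X c x (w x) + (\<Sum>i<k. c x ((w x)(i := deriv_along X (\<lambda>y. w y i) x)))"
proof -
  have da: "((\<lambda>y. c y u) has_derivative frechet_derivative (\<lambda>y. c y u) (at x)) (at x)" for u
    by (rule smooth_on_has_derivative[OF global_sections_smooth[OF c] UNIV_I])
  have dw: "((\<lambda>y. w y j) has_derivative frechet_derivative (\<lambda>y. w y j) (at x)) (at x)" if "j < k" for j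
    by (rule smooth_on_has_derivative[OF w[OF that] UNIV_I])
  note mem = global_sections_mem[OF c]
  show ?thesis
    using frechet_derivative_eqI[OF has_derivative_eval[OF mem frechet_derivative_family_in[OF mem da] da dw]]
    by (simp add: deriv_along_def sec_deriv_def)
qed

text \<open>Only slot \<open>i\<close> varies; the derivatives of the other slots are \<open>0\<close>, and so are the terms in which they
  are inserted.\<close>

lemma deriv_along_section_slot:
  assumes c: "c \<in> global_sections k" and i: "i < k" and g: "smooth_on UNIV g"
  shows "deriv_along X (\<lambda>y. c y (u(i := g y))) x =
    sec_deriv X c x (u(i := g x)) + c x (u(i := deriv_along X g x))"
proof -
  let ?w = "\<lambda>y. u(i := g y)"
  have "deriv_along X (\<lambda>y. c y (?w y)) x =
      sec_deriv X c x (?w x) + (\<Sum>j<k. c x ((?w x)(j := deriv_along X (\<lambda>y. ?w y j) x)))"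
    by (rule deriv_along_section_eval[OF c]) (intro smooth_on_fun_upd g smooth_on_const)
  also have "(\<Sum>j<k. c x ((?w x)(j := deriv_along X (\<lambda>y. ?w y j) x))) =
      (\<Sum>j<k. if j = i then c x (u(i := deriv_along X g x)) else 0)"
  proof (rule sum.cong[OF refl])
    fix j assume "j \<in> {..<k}"
    then have "c x ((?w x)(j := 0)) = 0"
      using linear_0[OF global_sections_slot_linear[OF c]] by blast
    then show "c x ((?w x)(j := deriv_along X (\<lambda>y. ?w y j) x)) =
        (if j = i then c x (u(i := deriv_along X g x)) else 0)"
      by (simp add: deriv_along_def)
  qed
  finally show ?thesis using i by (simp del: fun_upd_apply)
qed

lemma sec_deriv_in:
  assumes "smooth_on UNIV X" "c \<in> global_sections k"
  shows "sec_deriv X c \<in> global_sections k"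
proof (rule global_sectionsI)
  fix x
  have "((\<lambda>y. c y u) has_derivative frechet_derivative (\<lambda>y. c y u) (at x)) (at x)" for u
    by (rule smooth_on_has_derivative[OF global_sections_smooth[OF assms(2)] UNIV_I])
  from frechet_derivative_family_in[OF global_sections_mem[OF assms(2)] this]
  show "sec_deriv X c x \<in> sym_multilinear k" by (simp add: sec_deriv_def deriv_along_def)
next
  fix u
  show "smooth_on UNIV (\<lambda>x. sec_deriv X c x u)"
    unfolding sec_deriv_def
    by (intro smooth_on_deriv_along open_UNIV assms(1) global_sections_smooth[OF assms(2)])
qed

lemma endo_act_fibre_in:
  assumes e: "e \<in> sym_multilinear k" and T: "linear T"
  shows "(\<lambda>u. \<Sum>i<k. e (u(i := T (u i)))) \<in> sym_multilinear k"
proof (rule sym_multilinearI)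
  fix u v :: "nat \<Rightarrow> 'a" assume eq: "\<And>i. i < k \<Longrightarrow> u i = v i"
  show "(\<Sum>i<k. e (u(i := T (u i)))) = (\<Sum>i<k. e (v(i := T (v i))))"
    by (intro sum.cong refl sym_multilinear_cong[OF e]) (use eq in auto)
next
  fix u :: "nat \<Rightarrow> 'a" and j assume j: "j < k"
  have "linear (\<lambda>w. e ((u(j := w))(i := T ((u(j := w)) i))))" if i: "i < k" for i
  proof (cases "i = j")
    case True
    then show ?thesis
      using linear_compose[OF T sym_multilinear_linear[OF e j, of u]] by (simp add: comp_def)
  next
    case False
    then show ?thesis
      using sym_multilinear_linear[OF e j, of "u(i := T (u i))"] by (simp add: fun_upd_twist)
  qed
  then show "linear (\<lambda>w. \<Sum>i<k. e ((u(j := w))(i := T ((u(j := w)) i))))"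
    by (intro linear_compose_sum) simp
next
  fix \<pi> and u :: "nat \<Rightarrow> 'a" assume \<pi>: "\<pi> permutes {..<k}"
  have "e ((u \<circ> \<pi>)(i := T ((u \<circ> \<pi>) i))) = e (u(\<pi> i := T (u (\<pi> i))))" for i
  proof -
    \<comment> \<open>Modifying slot \<open>i\<close> after permuting is modifying slot \<open>\<pi> i\<close> before permuting.\<close>
    have "(u \<circ> \<pi>)(i := T ((u \<circ> \<pi>) i)) = u(\<pi> i := T (u (\<pi> i))) \<circ> \<pi>"
      using permutes_inj[OF \<pi>] by (auto simp: fun_eq_iff inj_eq)
    then show ?thesis using sym_multilinear_permute[OF e \<pi>] by simp
  qed
  then show "(\<Sum>i<k. e ((u \<circ> \<pi>)(i := T ((u \<circ> \<pi>) i)))) = (\<Sum>i<k. e (u(i := T (u i))))"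
    using sum.permute[OF \<pi>, of "\<lambda>i. e (u(i := T (u i)))"] by (simp add: comp_def)
qed

lemma endo_act_in:
  assumes T: "T \<in> endo_fields" and c: "c \<in> global_sections k"
  shows "endo_act k T c \<in> global_sections k"
proof (rule global_sectionsI)
  show "endo_act k T c x \<in> sym_multilinear k" for x
    unfolding endo_act_def
    by (rule endo_act_fibre_in[OF global_sections_mem[OF c]]) (use T in \<open>simp add: endo_fields_def\<close>)
  show "smooth_on UNIV (\<lambda>x. endo_act k T c x u)" for u
    unfolding endo_act_def
  proof (intro smooth_on_sum open_UNIV)
    fix i
    show "smooth_on UNIV (\<lambda>x. c x (u(i := T x (u i))))"
      using T by (intro smooth_on_section_eval[OF open_UNIV c] smooth_on_fun_upd smooth_on_const)
        (simp add: endo_fields_def)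
  qed
qed

lemma smooth_anchor_field: "a \<in> global_sections k \<Longrightarrow> smooth_on UNIV (anchor_field a)"
  unfolding anchor_def by (rule smooth_on_section_eval) (simp_all add: smooth_on_ident)

lemma Lam_in_endo_fields:
  assumes "k \<ge> 1" "a \<in> global_sections k"
  shows "Lam k a \<in> endo_fields"
proof -
  have "linear (Lam k a x)" for x
    unfolding Lam_def using global_sections_slot_linear[OF assms(2)] assms(1) by simp
  moreover have "smooth_on UNIV (\<lambda>x. Lam k a x u)" for u
    unfolding Lam_def
    by (intro smooth_on_section_eval[OF open_UNIV assms(2)] smooth_on_fun_upd smooth_on_const
        smooth_on_ident open_UNIV)
  ultimately show ?thesis by (simp add: endo_fields_def)
qed

lemma tri_in:
  "k \<ge> 1 \<Longrightarrow> a \<in> global_sections k \<Longrightarrow> b \<in> global_sections k \<Longrightarrow> tri k a b \<in> global_sections k"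
  unfolding tri_eq
  by (intro subspace_add[OF subspace_global_sections] sec_deriv_in smooth_anchor_field
      endo_act_in Lam_in_endo_fields)

lemma bracket_in:
  "k \<ge> 1 \<Longrightarrow> a \<in> global_sections k \<Longrightarrow> b \<in> global_sections k \<Longrightarrow> bracket k a b \<in> global_sections k"
  unfolding bracket_def by (intro subspace_diff[OF subspace_global_sections] tri_in)

lemma smooth_on_UNIV_has_derivative:
  "smooth_on UNIV f \<Longrightarrow> (f has_derivative frechet_derivative f (at x)) (at x)"
  by (rule smooth_on_has_derivative) auto

lemma deriv_along_add:
  "smooth_on UNIV f \<Longrightarrow> smooth_on UNIV g \<Longrightarrow>
    deriv_along X (\<lambda>y. f y + g y) x = deriv_along X f x + deriv_along X g x"
  unfolding deriv_along_def
  by (subst frechet_derivative_eqI[OF has_derivative_add]) (auto intro: smooth_on_UNIV_has_derivative)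

lemma deriv_along_sum:
  "(\<And>i. i \<in> I \<Longrightarrow> smooth_on UNIV (f i)) \<Longrightarrow>
    deriv_along X (\<lambda>y. \<Sum>i\<in>I. f i y) x = (\<Sum>i\<in>I. deriv_along X (f i) x)"
  unfolding deriv_along_def
  by (subst frechet_derivative_eqI[OF has_derivative_sum]) (auto intro: smooth_on_UNIV_has_derivative)

section \<open>Commutators of directional derivatives\<close>

lemma deriv_along_diff_field:
  "smooth_on UNIV f \<Longrightarrow> deriv_along (X - Y) f x = deriv_along X f x - deriv_along Y f x"
  unfolding deriv_along_def
  by (simp add: linear_diff[OF smooth_on_linear_derivative[of UNIV]])

text \<open>The first summand is the second derivative of \<open>f\<close> in the directions \<open>Y\<close> and \<open>X\<close>, which is symmetric;
  the second one survives in the commutator.\<close>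

lemma deriv_along_deriv_along:
  assumes f: "smooth_on UNIV f" and Y: "smooth_on UNIV Y"
  shows "deriv_along X (deriv_along Y f) x =
    (\<Sum>b\<in>Basis. (Y x \<bullet> b) *\<^sub>R frechet_derivative (\<lambda>y. frechet_derivative f (at y) b) (at x) (X x)) +
    frechet_derivative f (at x) (deriv_along X Y x)"
proof -
  let ?D = "\<lambda>y. frechet_derivative f (at y)"
  have "((\<lambda>y. \<Sum>b\<in>Basis. (Y y \<bullet> b) *\<^sub>R ?D y b) has_derivative
      (\<lambda>v. \<Sum>b\<in>Basis. (Y x \<bullet> b) *\<^sub>R frechet_derivative (\<lambda>y. ?D y b) (at x) v +
        (frechet_derivative Y (at x) v \<bullet> b) *\<^sub>R ?D x b)) (at x)"
    by (intro has_derivative_sum has_derivative_scaleR has_derivative_inner_left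
        smooth_on_UNIV_has_derivative smooth_on_frechet_derivative f Y)
  moreover have "deriv_along Y f = (\<lambda>y. \<Sum>b\<in>Basis. (Y y \<bullet> b) *\<^sub>R ?D y b)"
    using deriv_along_expansion[OF f] by blast
  ultimately have "deriv_along X (deriv_along Y f) x =
      (\<Sum>b\<in>Basis. (Y x \<bullet> b) *\<^sub>R frechet_derivative (\<lambda>y. ?D y b) (at x) (X x)) +
      (\<Sum>b\<in>Basis. (deriv_along X Y x \<bullet> b) *\<^sub>R ?D x b)"
    by (simp add: deriv_along_def[of X] frechet_derivative_eqI sum.distrib)
  also have "(\<Sum>b\<in>Basis. (deriv_along X Y x \<bullet> b) *\<^sub>R ?D x b) = ?D x (deriv_along X Y x)"
    by (rule linear_Basis_expansion[OF smooth_on_linear_derivative[OF f UNIV_I], symmetric])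
  finally show ?thesis .
qed

lemma deriv_along_commutator:
  fixes f :: "'v::euclidean_space \<Rightarrow> 'b::euclidean_space"
  assumes f: "smooth_on UNIV f" and X: "smooth_on UNIV X" and Y: "smooth_on UNIV Y"
  shows "deriv_along X (deriv_along Y f) x - deriv_along Y (deriv_along X f) x =
    deriv_along (vf_bracket X Y) f x"
proof -
  let ?H = "\<lambda>b. frechet_derivative (\<lambda>y. frechet_derivative f (at y) b) (at x)"
  have H: "?H b v = (\<Sum>c\<in>Basis. (v \<bullet> c) *\<^sub>R ?H b c)" for b v
    by (rule linear_Basis_expansion[OF smooth_on_linear_derivative[OF smooth_on_frechet_derivative[OF f] UNIV_I]])
  have "(\<Sum>b\<in>Basis. (Y x \<bullet> b) *\<^sub>R ?H b (X x)) =
      (\<Sum>b\<in>Basis. \<Sum>c\<in>Basis. ((Y x \<bullet> b) * (X x \<bullet> c)) *\<^sub>R ?H b c)"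
    by (subst H) (simp add: scaleR_sum_right)
  also have "\<dots> = (\<Sum>c\<in>Basis. \<Sum>b\<in>Basis. ((Y x \<bullet> b) * (X x \<bullet> c)) *\<^sub>R ?H b c)"
    by (rule sum.swap)
  also have "\<dots> = (\<Sum>c\<in>Basis. \<Sum>b\<in>Basis. ((X x \<bullet> c) * (Y x \<bullet> b)) *\<^sub>R ?H c b)"
    by (intro sum.cong refl) (simp add: mult.commute second_derivative_symmetric[OF open_UNIV f UNIV_I])
  also have "\<dots> = (\<Sum>c\<in>Basis. (X x \<bullet> c) *\<^sub>R ?H c (Y x))"
    by (subst H[of _ "Y x"]) (simp add: scaleR_sum_right)
  finally show ?thesis
    unfolding deriv_along_deriv_along[OF f Y] deriv_along_deriv_along[OF f X] vf_bracket_def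
    by (simp add: deriv_along_def[of _ f] linear_diff[OF smooth_on_linear_derivative[OF f UNIV_I]])
qed

section \<open>The product on sections and its curvature\<close>

lemma sec_deriv_add:
  "c \<in> global_sections k \<Longrightarrow> d \<in> global_sections k \<Longrightarrow>
    sec_deriv X (c + d) = sec_deriv X c + sec_deriv X d"
  by (intro ext) (simp add: sec_deriv_def deriv_along_add global_sections_smooth)

lemma sec_deriv_diff_field:
  "c \<in> global_sections k \<Longrightarrow> sec_deriv (X - Y) c = sec_deriv X c - sec_deriv Y c"
  by (intro ext) (simp add: sec_deriv_def deriv_along_diff_field global_sections_smooth)

lemma endo_act_add: "endo_act k T (c + d) = endo_act k T c + endo_act k T d"
  by (intro ext) (simp add: endo_act_def sum.distrib)

lemma endo_act_add_endo:
  "c \<in> global_sections k \<Longrightarrow> endo_act k (T + S) c = endo_act k T c + endo_act k S c"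
  by (intro ext)
    (simp add: endo_act_def sum.distrib[symmetric] linear_add[OF global_sections_slot_linear])

lemma endo_act_diff_endo:
  "c \<in> global_sections k \<Longrightarrow> endo_act k (T - S) c = endo_act k T c - endo_act k S c"
  by (intro ext)
    (simp add: endo_act_def sum_subtractf[symmetric] linear_diff[OF global_sections_slot_linear])

text \<open>Flatness of the connection \<open>D\<close> on sections.\<close>

lemma sec_deriv_commutator:
  assumes "smooth_on UNIV X" "smooth_on UNIV Y" "c \<in> global_sections k"
  shows "sec_deriv X (sec_deriv Y c) - sec_deriv Y (sec_deriv X c) = sec_deriv (vf_bracket X Y) c"
  by (intro ext)
    (use deriv_along_commutator[OF global_sections_smooth[OF assms(3)] assms(1,2)] in
      \<open>simp add: sec_deriv_def\<close>)

text \<open>The derivation action is parallel, so \<open>D\<close> satisfies the Leibniz rule with respect to it.\<close>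

lemma sec_deriv_endo_act:
  assumes T: "T \<in> endo_fields" and c: "c \<in> global_sections k"
  shows "sec_deriv X (endo_act k T c) = endo_act k T (sec_deriv X c) + endo_act k (endo_deriv X T) c"
proof (intro ext)
  fix x u
  have T': "smooth_on UNIV (\<lambda>x. T x w)" for w using T by (simp add: endo_fields_def)
  have "sec_deriv X (endo_act k T c) x u = (\<Sum>i<k. deriv_along X (\<lambda>y. c y (u(i := T y (u i)))) x)"
    unfolding sec_deriv_def endo_act_def
    by (rule deriv_along_sum, rule smooth_on_section_eval[OF open_UNIV c])
      (intro smooth_on_fun_upd T' smooth_on_const)
  also have "\<dots> = (\<Sum>i<k. sec_deriv X c x (u(i := T x (u i))) + c x (u(i := endo_deriv X T x (u i))))"
    unfolding endo_deriv_def
    by (intro sum.cong refl deriv_along_section_slot[OF c _ T']) simp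
  finally show "sec_deriv X (endo_act k T c) x u =
      (endo_act k T (sec_deriv X c) + endo_act k (endo_deriv X T) c) x u"
    by (simp add: sum.distrib endo_act_def)
qed

definition endo_comp :: "('v \<Rightarrow> 'v \<Rightarrow> 'v) \<Rightarrow> ('v \<Rightarrow> 'v \<Rightarrow> 'v) \<Rightarrow> 'v \<Rightarrow> 'v \<Rightarrow> 'v" where
  "endo_comp S T = (\<lambda>x u. S x (T x u))"

text \<open>Terms with \<open>T\<close> and \<open>S\<close> in two different slots are symmetric in \<open>T\<close> and \<open>S\<close> and cancel; only those
  with both in the same slot remain. The order of composition is reversed because the endomorphisms act on
  arguments.\<close>

lemma endo_act_commutator:
  "endo_act k T (endo_act k S c) - endo_act k S (endo_act k T c) =
    endo_act k (endo_comp S T) c - endo_act k (endo_comp T S) c"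
proof (intro ext)
  fix x u
  \<comment> \<open>The contribution of \<open>T\<close> in slot \<open>i\<close> and \<open>S\<close> in slot \<open>j \<noteq> i\<close>.\<close>
  define G where "G T S i j = (if i = j then 0 else c x (u(i := T x (u i), j := S x (u j))))"
    for T S :: "'a \<Rightarrow> 'a \<Rightarrow> 'a" and i j
  have act: "endo_act k T (endo_act k S c) x u =
      endo_act k (endo_comp S T) c x u + (\<Sum>i<k. \<Sum>j<k. G T S i j)" for T S
  proof -
    have "(\<Sum>j<k. c x ((u(i := T x (u i)))(j := S x ((u(i := T x (u i))) j)))) =
        c x (u(i := S x (T x (u i)))) + (\<Sum>j<k. G T S i j)" if i: "i < k" for i
    proof -
      have "(\<Sum>j\<in>{..<k} - {i}. c x ((u(i := T x (u i)))(j := S x ((u(i := T x (u i))) j)))) =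
          (\<Sum>j\<in>{..<k} - {i}. G T S i j)"
        by (rule sum.cong) (auto simp: G_def)
      moreover have "G T S i i = 0" by (simp add: G_def)
      ultimately show ?thesis using i by (simp add: sum.remove[of "{..<k}" i])
    qed
    then show ?thesis by (simp add: endo_act_def endo_comp_def sum.distrib del: fun_upd_apply)
  qed
  have "(\<Sum>i<k. \<Sum>j<k. G T S i j) = (\<Sum>j<k. \<Sum>i<k. G T S i j)" by (rule sum.swap)
  also have "\<dots> = (\<Sum>j<k. \<Sum>i<k. G S T j i)"
    by (intro sum.cong refl) (auto simp: G_def fun_upd_twist)
  finally show "(endo_act k T (endo_act k S c) - endo_act k S (endo_act k T c)) x u =
      (endo_act k (endo_comp S T) c - endo_act k (endo_comp T S) c) x u"
    by (simp add: act)
qed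

text \<open>The product rule for \<open>b\<^sub>x(x, \<dots>, x)\<close> inserts \<open>\<rho>(a)\<close> in each slot in turn, and \<open>\<rho>(a) = \<Lambda>\<^sub>a x\<close>.\<close>

lemma anchor_field_tri:
  assumes a: "a \<in> global_sections k" and b: "b \<in> global_sections k"
  shows "anchor_field (tri k a b) = deriv_along (anchor_field a) (anchor_field b)"
proof
  fix x
  have "deriv_along X (\<lambda>y. y) x = X x" for X :: "'a \<Rightarrow> 'a" by (simp add: deriv_along_def)
  moreover have "Lam k a x x = anchor x (a x)"
    by (simp add: Lam_def anchor_def fun_upd_idem)
  ultimately show "anchor_field (tri k a b) x = deriv_along (anchor_field a) (anchor_field b) x"
    using deriv_along_section_eval[OF b, of "\<lambda>y _. y" "anchor_field a" x]
    by (simp add: anchor_def tri_eq endo_act_def smooth_on_ident)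
qed

text \<open>The product rule for \<open>b\<^sub>x(x, \<dots>, x, v)\<close> inserts \<open>\<rho>(a) = \<Lambda>\<^sub>a x\<close> in all slots but the last one, where
  \<open>v\<close> is constant. The term of \<open>\<Lambda>\<^sub>a b\<close> for the last slot is the only one not accounted for in this way, and it is
  \<open>\<Lambda>\<^sub>b (\<Lambda>\<^sub>a v)\<close>.\<close>

lemma Lam_tri:
  assumes k: "k \<ge> 1" and a: "a \<in> global_sections k" and b: "b \<in> global_sections k"
  shows "Lam k (tri k a b) = endo_deriv (anchor_field a) (Lam k b) + endo_comp (Lam k b) (Lam k a)"
proof (intro ext)
  fix x v :: 'a
  let ?w = "\<lambda>y :: 'a. (\<lambda>_ :: nat. y)(k - 1 := v)" and ?X = "anchor_field a"
  have split_last: "(\<Sum>i<k. f i) = (\<Sum>i<k - 1. f i) + f (k - 1)" for f :: "nat \<Rightarrow> 'a"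
    using k sum.lessThan_Suc[of f "k - 1"] by simp
  have "deriv_along ?X (\<lambda>y. b y (?w y)) x =
      sec_deriv ?X b x (?w x) + (\<Sum>i<k. b x ((?w x)(i := deriv_along ?X (\<lambda>y. ?w y i) x)))"
    by (rule deriv_along_section_eval[OF b]) (intro smooth_on_fun_upd smooth_on_const smooth_on_ident open_UNIV)
  also have "(\<Sum>i<k. b x ((?w x)(i := deriv_along ?X (\<lambda>y. ?w y i) x))) =
      (\<Sum>i<k - 1. b x ((?w x)(i := ?X x)))"
  proof -
    have "b x ((?w x)(k - 1 := 0)) = 0"
      using linear_0[OF global_sections_slot_linear[OF b, of "k - 1"]] k by simp
    moreover have "(\<Sum>i<k - 1. b x ((?w x)(i := deriv_along ?X (\<lambda>y. ?w y i) x))) =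
        (\<Sum>i<k - 1. b x ((?w x)(i := ?X x)))"
      by (rule sum.cong) (auto simp: deriv_along_def)
    ultimately show ?thesis unfolding split_last by (simp add: deriv_along_def)
  qed
  finally have "endo_deriv ?X (Lam k b) x v =
      sec_deriv ?X b x (?w x) + (\<Sum>i<k - 1. b x ((?w x)(i := ?X x)))"
    by (simp add: endo_deriv_def Lam_def del: fun_upd_apply)
  moreover have "endo_act k (Lam k a) b x (?w x) =
      (\<Sum>i<k - 1. b x ((?w x)(i := ?X x))) + b x ((\<lambda>_. x)(k - 1 := Lam k a x v))"
  proof -
    have "Lam k a x x = ?X x" by (simp add: Lam_def anchor_def fun_upd_idem)
    then have "(\<Sum>i<k - 1. b x ((?w x)(i := Lam k a x (?w x i)))) = (\<Sum>i<k - 1. b x ((?w x)(i := ?X x)))"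
      by (intro sum.cong) auto
    then show ?thesis unfolding endo_act_def split_last by simp
  qed
  moreover have "endo_comp (Lam k b) (Lam k a) x v = b x ((\<lambda>_. x)(k - 1 := Lam k a x v))"
    by (simp add: endo_comp_def Lam_def)
  moreover have "Lam k (tri k a b) x v = sec_deriv ?X b x (?w x) + endo_act k (Lam k a) b x (?w x)"
    by (simp add: tri_eq Lam_def)
  ultimately show "Lam k (tri k a b) x v =
      (endo_deriv ?X (Lam k b) + endo_comp (Lam k b) (Lam k a)) x v"
    by simp
qed

lemma tri_diff_left:
  assumes c: "c \<in> global_sections k"
  shows "tri k (a - b) c = tri k a c - tri k b c"
proof -
  have "anchor_field (a - b) = anchor_field a - anchor_field b" by (simp add: anchor_def fun_eq_iff)
  moreover have "Lam k (a - b) = Lam k a - Lam k b" by (simp add: Lam_def fun_eq_iff)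
  ultimately show ?thesis
    by (simp add: tri_eq sec_deriv_diff_field[OF c] endo_act_diff_endo[OF c])
qed

lemma tri_add_left:
  assumes "c \<in> global_sections k"
  shows "tri k (a + b) c = tri k a c + tri k b c"
  using tri_diff_left[OF assms, of "a + b" b] by simp

lemma tri_add_right:
  assumes "c \<in> global_sections k" "d \<in> global_sections k"
  shows "tri k a (c + d) = tri k a c + tri k a d"
  by (simp add: tri_eq sec_deriv_add[OF assms] endo_act_add)

lemma tri_diff_right:
  assumes "c \<in> global_sections k" "d \<in> global_sections k"
  shows "tri k a (c - d) = tri k a c - tri k a d"
  using tri_add_right[OF subspace_diff[OF subspace_global_sections assms] assms(2), of a] by simp

text \<open>The cross terms \<open>\<Lambda>\<^sub>b (D\<^bsub>\<rho>(a)\<^esub> c)\<close> and \<open>\<Lambda>\<^sub>a (D\<^bsub>\<rho>(b)\<^esub> c)\<close> occur symmetrically and cancel. What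
  remains are the commutators of the derivatives and of the actions together with the derivatives of \<open>\<Lambda>\<close>; by
  \<open>anchor_field_tri\<close> and \<open>Lam_tri\<close> these are the two parts of \<open>[a,b] \<triangleright> c\<close>.\<close>

lemma tri_flat:
  assumes k: "k \<ge> 1" and a: "a \<in> global_sections k" and b: "b \<in> global_sections k"
    and c: "c \<in> global_sections k"
  shows "tri k (bracket k a b) c = tri k a (tri k b c) - tri k b (tri k a c)"
proof -
  let ?A = "anchor_field a" and ?B = "anchor_field b"
  note smooth = smooth_anchor_field[OF a] smooth_anchor_field[OF b]
  note endo = Lam_in_endo_fields[OF k a] Lam_in_endo_fields[OF k b]
  have expand: "tri k p (tri k q c) = sec_deriv (anchor_field p) (sec_deriv (anchor_field q) c) +
      endo_act k (Lam k q) (sec_deriv (anchor_field p) c) +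
      endo_act k (endo_deriv (anchor_field p) (Lam k q)) c +
      endo_act k (Lam k p) (sec_deriv (anchor_field q) c) + endo_act k (Lam k p) (endo_act k (Lam k q) c)"
    if p: "p \<in> global_sections k" and q: "q \<in> global_sections k" for p q
  proof -
    note q_in = sec_deriv_in[OF smooth_anchor_field[OF q] c] endo_act_in[OF Lam_in_endo_fields[OF k q] c]
    show ?thesis
      unfolding tri_eq sec_deriv_add[OF q_in] endo_act_add
        sec_deriv_endo_act[OF Lam_in_endo_fields[OF k q] c]
      by (simp add: add.assoc)
  qed
  have "tri k a (tri k b c) - tri k b (tri k a c) =
      (sec_deriv ?A (sec_deriv ?B c) - sec_deriv ?B (sec_deriv ?A c)) +
      (endo_act k (endo_deriv ?A (Lam k b)) c - endo_act k (endo_deriv ?B (Lam k a)) c) +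
      (endo_act k (Lam k a) (endo_act k (Lam k b) c) - endo_act k (Lam k b) (endo_act k (Lam k a) c))"
    unfolding expand[OF a b] expand[OF b a] by (simp add: algebra_simps)
  also have "\<dots> = sec_deriv (vf_bracket ?A ?B) c +
      (endo_act k (endo_deriv ?A (Lam k b)) c - endo_act k (endo_deriv ?B (Lam k a)) c) +
      (endo_act k (endo_comp (Lam k b) (Lam k a)) c - endo_act k (endo_comp (Lam k a) (Lam k b)) c)"
    unfolding sec_deriv_commutator[OF smooth c] endo_act_commutator ..
  also have "\<dots> = tri k (tri k a b) c - tri k (tri k b a) c"
    unfolding tri_eq[of k "tri k a b"] tri_eq[of k "tri k b a"] anchor_field_tri[OF a b] anchor_field_tri[OF b a]
      Lam_tri[OF k a b] Lam_tri[OF k b a] endo_act_add_endo[OF c] vf_bracket_def sec_deriv_diff_field[OF c]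
    by (simp add: algebra_simps)
  also have "\<dots> = tri k (bracket k a b) c"
    unfolding bracket_def tri_diff_left[OF c] ..
  finally show ?thesis ..
qed

text \<open>Flatness replaces \<open>[b,c] \<triangleright> a\<close> by products of the form \<open>p \<triangleright> (q \<triangleright> r)\<close>. Each of the six such products
  then occurs with both signs in the cyclic sum.\<close>

lemma bracket_jacobi:
  assumes k: "k \<ge> 1" and a: "a \<in> global_sections k" and b: "b \<in> global_sections k"
    and c: "c \<in> global_sections k"
  shows "bracket k a (bracket k b c) + bracket k b (bracket k c a) + bracket k c (bracket k a b) = 0"
proof -
  have "bracket k p (bracket k q r) =
      tri k p (tri k q r) - tri k p (tri k r q) - (tri k q (tri k r p) - tri k r (tri k q p))"
    if p: "p \<in> global_sections k" and q: "q \<in> global_sections k" and r: "r \<in> global_sections k" for p q r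
    using tri_flat[OF k q r p] tri_diff_right[OF tri_in[OF k q r] tri_in[OF k r q], of p]
    by (simp add: bracket_def)
  from this[OF a b c] this[OF b c a] this[OF c a b] show ?thesis by simp
qed

section \<open>The Lie algebroid\<close>

lemma deriv_along_scaleR:
  assumes "smooth_on UNIV f" "smooth_on UNIV g"
  shows "deriv_along X (\<lambda>y. f y *\<^sub>R g y) x = f x *\<^sub>R deriv_along X g x + deriv_along X f x *\<^sub>R g x"
  unfolding deriv_along_def
  by (subst frechet_derivative_eqI[OF has_derivative_scaleR]) (auto intro: smooth_on_UNIV_has_derivative assms)

lemma tri_leibniz_right:
  assumes b: "b \<in> global_sections k" and f: "smooth_on UNIV f"
  shows "tri k a (\<lambda>x. f x *\<^sub>R b x) =
    (\<lambda>x. f x *\<^sub>R tri k a b x + deriv_along (anchor_field a) f x *\<^sub>R b x)"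
  by (intro ext)
    (simp add: tri_def scaleR_fun_apply deriv_along_scaleR[OF f global_sections_smooth[OF b]]
      scaleR_sum_right scaleR_add_right)

lemma tri_scale_left:
  assumes b: "b \<in> global_sections k"
  shows "tri k (\<lambda>x. f x *\<^sub>R a x) b = (\<lambda>x. f x *\<^sub>R tri k a b x)"
proof (intro ext)
  fix x u
  show "tri k (\<lambda>x. f x *\<^sub>R a x) b x u = (f x *\<^sub>R tri k a b x) u"
    by (simp add: tri_def scaleR_fun_apply anchor_def Lam_def deriv_along_def scaleR_add_right scaleR_sum_right
        linear_scale[OF smooth_on_linear_derivative[OF global_sections_smooth[OF b] UNIV_I]]
        linear_scale[OF global_sections_slot_linear[OF b]])
qed

lemma bracket_leibniz:
  assumes a: "a \<in> global_sections k" and b: "b \<in> global_sections k"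
    and f: "smooth_on UNIV f"
  shows "bracket k a (\<lambda>x. f x *\<^sub>R b x) =
    (\<lambda>x. f x *\<^sub>R bracket k a b x + deriv_along (anchor_field a) f x *\<^sub>R b x)"
  unfolding bracket_def tri_leibniz_right[OF b f] tri_scale_left[OF a]
  by (simp add: fun_eq_iff algebra_simps)

lemma lie_algebra_global_sections:
  assumes k: "k \<ge> 1"
  shows "lie_algebra_on (global_sections k) (bracket k)"
proof
  show "subspace (global_sections k)" by (rule subspace_global_sections)
next
  fix r :: real and a b :: "'a \<Rightarrow> (nat \<Rightarrow> 'a) \<Rightarrow> 'a"
  assume a: "a \<in> global_sections k" and b: "b \<in> global_sections k"
  have "bracket k p (r *\<^sub>R q) = r *\<^sub>R bracket k p q"
    if p: "p \<in> global_sections k" and q: "q \<in> global_sections k" for p q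
    using bracket_leibniz[OF p q smooth_on_const[of _ r]]
    by (simp add: scaleR_fun_def deriv_along_def fun_eq_iff)
  note scale = this
  then show "bracket k a (r *\<^sub>R b) = r *\<^sub>R bracket k a b" using a b .
  have "bracket k (r *\<^sub>R a) b = - bracket k b (r *\<^sub>R a)" by (simp add: bracket_def)
  also have "\<dots> = r *\<^sub>R bracket k a b" unfolding scale[OF b a] by (simp add: bracket_def algebra_simps)
  finally show "bracket k (r *\<^sub>R a) b = r *\<^sub>R bracket k a b" .
next
  fix a b :: "'a \<Rightarrow> (nat \<Rightarrow> 'a) \<Rightarrow> 'a"
  assume a: "a \<in> global_sections k" and b: "b \<in> global_sections k"
  show "bracket k a b \<in> global_sections k" by (rule bracket_in[OF k a b])
  show "bracket k a a = 0" by (simp add: bracket_def)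
  fix c :: "'a \<Rightarrow> (nat \<Rightarrow> 'a) \<Rightarrow> 'a" assume c: "c \<in> global_sections k"
  show "bracket k (a + b) c = bracket k a c + bracket k b c"
    by (simp add: bracket_def tri_add_left[OF c] tri_add_right[OF a b])
  show "bracket k a (b + c) = bracket k a b + bracket k a c"
    by (simp add: bracket_def tri_add_left[OF a] tri_add_right[OF b c])
  show "bracket k a (bracket k b c) + bracket k b (bracket k c a) + bracket k c (bracket k a b) = 0"
    by (rule bracket_jacobi[OF k a b c])
qed

lemma trivial_lie_algebroid_sym_multilinear:
  assumes k: "k \<ge> 1"
  shows "trivial_lie_algebroid (sym_multilinear k :: ((nat \<Rightarrow> 'v::euclidean_space) \<Rightarrow> 'v) set) anchor (bracket k)"
proof (rule trivial_lie_algebroid.intro)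
  show "subspace (sym_multilinear k :: ((nat \<Rightarrow> 'v) \<Rightarrow> 'v) set)" by (rule subspace_sym_multilinear)
  show "\<exists>B. finite B \<and> span B = (sym_multilinear k :: ((nat \<Rightarrow> 'v) \<Rightarrow> 'v) set)"
    using sym_multilinear_basis by metis
  show "lie_algebra_on (global_sections k :: ('v \<Rightarrow> _) set) (bracket k)" by (rule lie_algebra_global_sections[OF k])
next
  fix e :: "(nat \<Rightarrow> 'v) \<Rightarrow> 'v" assume e: "e \<in> sym_multilinear k"
  then have "(\<lambda>_. e) \<in> global_sections k" by (intro global_sectionsI) (simp_all add: smooth_on_const)
  from smooth_anchor_field[OF this] show "smooth_on UNIV (\<lambda>x. anchor x e)" .
next
  fix a b :: "'v \<Rightarrow> (nat \<Rightarrow> 'v) \<Rightarrow> 'v" and f :: "'v \<Rightarrow> real"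
  assume a: "a \<in> global_sections k" and b: "b \<in> global_sections k"
  {
    assume "f \<in> smooth_funs UNIV"
    then have "smooth_on UNIV f" by (simp add: smooth_maps_def)
    then show "bracket k a (\<lambda>x. f x *\<^sub>R b x) =
        (\<lambda>x. f x *\<^sub>R bracket k a b x + deriv_along (\<lambda>y. anchor y (a y)) f x *\<^sub>R b x)"
      by (rule bracket_leibniz[OF a b])
  }
  show "(\<lambda>x. anchor x (bracket k a b x)) = vf_bracket (\<lambda>x. anchor x (a x)) (\<lambda>x. anchor x (b x))"
    using anchor_field_tri[OF a b] anchor_field_tri[OF b a]
    by (simp add: vf_bracket_def bracket_def anchor_def fun_eq_iff)
qed (simp_all add: anchor_def scaleR_fun_apply)

section \<open>The image of the anchor\<close>

lemma smooth_maps_restrict: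
  "open U \<Longrightarrow> smooth_on U f \<Longrightarrow> restrict f U \<in> smooth_maps U"
  unfolding smooth_maps_def using smooth_on_cong[of U "restrict f U" f] by simp

text \<open>A single neighbourhood, \<open>U\<close> itself, serves all points: the monomials are indexed by the basis tuples,
  and each factor \<open>\<langle>x, t\<^sub>i\<rangle>\<close> vanishes at the origin.\<close>

lemma anchor_section_in_foliation:
  fixes a :: "'v::euclidean_space \<Rightarrow> (nat \<Rightarrow> 'v) \<Rightarrow> 'v"
  assumes U: "open U" and a: "a \<in> sections U (sym_multilinear k)"
  shows "anchor_on U a \<in> foliation k U"
proof -
  obtain ts where ts: "distinct ts" "set ts = (basis_tuples k :: (nat \<Rightarrow> 'v) set)"
    using finite_distinct_list[OF finite_basis_tuples] by metis
  have smooth: "smooth_on U (\<lambda>x. anchor x (a x))"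
    unfolding anchor_def by (rule smooth_on_section_eval[OF U a]) (rule smooth_on_ident[OF U])
  define f where "f j i = (\<lambda>x\<in>U. x \<bullet> (ts ! j) i)" for j i :: nat
  define Y where "Y j = (\<lambda>x\<in>U. a x (ts ! j))" for j :: nat
  have f_in: "f j i \<in> ideal0 U" for j i
    unfolding ideal0_def f_def
    by (simp add: smooth_maps_restrict[OF U] smooth_on_inner[OF U smooth_on_ident[OF U] smooth_on_const])
  have Y_in: "Y j \<in> vector_fields U" for j
    unfolding Y_def by (intro smooth_maps_restrict[OF U] smooth_on_section_apply[OF U a])
  have eq: "anchor_on U a x = (\<Sum>j<length ts. (\<Prod>i<k. f j i x) *\<^sub>R Y j x)" if "x \<in> U" for x
  proof -
    have "anchor_on U a x = a x (\<lambda>_. x)" using that by (simp add: anchor_on_def anchor_def)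
    also have "\<dots> = (\<Sum>t\<in>basis_tuples k. (\<Prod>i<k. x \<bullet> t i) *\<^sub>R a x t)"
      by (rule multilinear_expansion[OF sections_mem[OF a that]])
    also have "\<dots> = (\<Sum>j<length ts. (\<Prod>i<k. x \<bullet> (ts ! j) i) *\<^sub>R a x (ts ! j))"
      unfolding ts(2)[symmetric]
      by (rule sum.reindex_bij_betw[OF bij_betw_nth[OF ts(1) refl refl], symmetric])
    finally show ?thesis using that by (simp add: f_def Y_def)
  qed
  have "\<exists>W. open W \<and> p \<in> W \<and> W \<subseteq> U \<and>
      (\<exists>(m::nat) (f :: nat \<Rightarrow> nat \<Rightarrow> 'v \<Rightarrow> real) (Y :: nat \<Rightarrow> 'v \<Rightarrow> 'v).
        (\<forall>j<m. (\<forall>i<k. f j i \<in> ideal0 W) \<and> Y j \<in> vector_fields W) \<and>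
        (\<forall>x\<in>W. anchor_on U a x = (\<Sum>j<m. (\<Prod>i<k. f j i x) *\<^sub>R Y j x)))" if "p \<in> U" for p
    by (intro exI[of _ U] exI[of _ "length ts"] exI[of _ f] exI[of _ Y] conjI allI impI ballI)
      (rule U that subset_refl f_in Y_in | erule eq)+
  moreover have "anchor_on U a \<in> vector_fields U"
    unfolding anchor_on_def by (rule smooth_maps_restrict[OF U smooth])
  ultimately show ?thesis unfolding foliation_def by blast
qed

text \<open>The symmetric map \<open>u \<mapsto> (\<Prod>i. \<langle>u\<^sub>i, x\<rangle> / |x|\<^sup>2) X x\<close>; the inverse factorial compensates for the number of
  terms of the symmetrisation. At \<open>x = 0\<close> the convention \<open>inverse 0 = 0\<close> still gives an element of the fibre.\<close>

definition radial_lift :: "nat \<Rightarrow> ('v \<Rightarrow> 'v) \<Rightarrow> 'v::euclidean_space \<Rightarrow> (nat \<Rightarrow> 'v) \<Rightarrow> 'v" where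
  "radial_lift k X x = sym_tensor k (\<lambda>_. inverse (x \<bullet> x) *\<^sub>R x) (inverse (fact k) *\<^sub>R X x)"

lemma anchor_radial_lift: "x \<noteq> 0 \<Longrightarrow> anchor x (radial_lift k X x) = X x"
  by (simp add: anchor_def radial_lift_def sym_tensor_diagonal)

lemma smooth_on_radial_lift:
  assumes U: "open U" "0 \<notin> U" and X: "smooth_on U X"
  shows "smooth_on U (\<lambda>x. radial_lift k X x u)"
  unfolding radial_lift_def
proof (intro smooth_on_sym_tensor smooth_on_scaleR smooth_on_inverse_pos smooth_on_inner smooth_on_const
    smooth_on_ident U X)
  fix x assume "x \<in> U"
  then show "0 < x \<bullet> x" using U(2) by auto
qed simp

text \<open>By Hadamard's lemma each \<open>f j i\<close> is \<open>\<langle>x, g j i x\<rangle>\<close>; symmetrising \<open>\<Prod>i. \<langle>u\<^sub>i, g j i x\<rangle> Y j x\<close> gives a map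
  whose value at \<open>(x, \<dots>, x)\<close> is the given sum.\<close>

lemma local_lift_at_0:
  fixes f :: "nat \<Rightarrow> nat \<Rightarrow> 'v::euclidean_space \<Rightarrow> real" and Y :: "nat \<Rightarrow> 'v \<Rightarrow> 'v"
  assumes f: "\<And>j i. j < m \<Longrightarrow> i < k \<Longrightarrow> smooth_on (ball 0 e) (f j i)"
    and f0: "\<And>j i. j < m \<Longrightarrow> i < k \<Longrightarrow> f j i 0 = 0"
    and Y: "\<And>j. j < m \<Longrightarrow> smooth_on (ball 0 e) (Y j)"
  obtains a :: "'v \<Rightarrow> (nat \<Rightarrow> 'v) \<Rightarrow> 'v" where
    "\<And>x. a x \<in> sym_multilinear k" "\<And>u. smooth_on (ball 0 e) (\<lambda>x. a x u)"
    "\<And>x. x \<in> ball 0 e \<Longrightarrow> anchor x (a x) = (\<Sum>j<m. (\<Prod>i<k. f j i x) *\<^sub>R Y j x)"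
proof -
  have "\<exists>g. smooth_on (ball 0 e) g \<and> (\<forall>x\<in>ball 0 e. f j i x = x \<bullet> g x)" if "j < m" "i < k" for j i
    by (rule hadamard[OF f[OF that] f0[OF that]]) blast
  then obtain g where g: "\<And>j i. j < m \<Longrightarrow> i < k \<Longrightarrow> smooth_on (ball 0 e) (g j i)"
    "\<And>j i x. j < m \<Longrightarrow> i < k \<Longrightarrow> x \<in> ball 0 e \<Longrightarrow> f j i x = x \<bullet> g j i x"
    by metis
  define a where "a x = (\<Sum>j<m. sym_tensor k (\<lambda>i. g j i x) (inverse (fact k) *\<^sub>R Y j x))" for x
  show thesis
  proof
    show "a x \<in> sym_multilinear k" for x
      unfolding a_def by (intro subspace_sum[OF subspace_sym_multilinear] sym_tensor_in)
    show "smooth_on (ball 0 e) (\<lambda>x. a x u)" for u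
      unfolding a_def fun_sum_apply
      by (intro smooth_on_sum smooth_on_sym_tensor smooth_on_scale_const open_ball g(1) Y) auto
    show "anchor x (a x) = (\<Sum>j<m. (\<Prod>i<k. f j i x) *\<^sub>R Y j x)" if "x \<in> ball 0 e" for x
      unfolding anchor_def a_def fun_sum_apply sym_tensor_diagonal
    proof (rule sum.cong[OF refl])
      fix j assume j: "j \<in> {..<m}"
      have "(\<Prod>i<k. x \<bullet> g j i x) = (\<Prod>i<k. f j i x)"
        by (rule prod.cong[OF refl]) (use j g(2) that in simp)
      then show "(fact k * (\<Prod>i<k. x \<bullet> g j i x)) *\<^sub>R inverse (fact k) *\<^sub>R Y j x =
          (\<Prod>i<k. f j i x) *\<^sub>R Y j x" by simp
    qed
  qed
qed

lemma foliation_lift_away_from_0: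
  fixes X :: "'v::euclidean_space \<Rightarrow> 'v"
  assumes U: "open U" "0 \<notin> U" and X: "X \<in> vector_fields U"
  shows "X \<in> anchor_on U ` sections U (sym_multilinear k)"
proof
  have smooth: "smooth_on U X" and ext: "X \<in> extensional U" using X by (auto simp: smooth_maps_def)
  let ?a = "restrict (radial_lift k X) U"
  show "?a \<in> sections U (sym_multilinear k)"
  proof (rule sections_symI[OF U(1)])
    show "smooth_on U (\<lambda>x. ?a x u)" for u
      using smooth_on_cong[OF U(1), of "\<lambda>x. ?a x u" "\<lambda>x. radial_lift k X x u"]
        smooth_on_radial_lift[OF U smooth] by simp
  qed (simp_all add: radial_lift_def sym_tensor_in)
  show "X = anchor_on U ?a"
  proof (rule extensionalityI[OF ext])
    fix x assume "x \<in> U"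
    moreover from this have "x \<noteq> 0" using U(2) by metis
    ultimately show "X x = anchor_on U ?a x"
      by (simp add: anchor_on_def anchor_radial_lift)
  qed (simp add: anchor_on_def)
qed

text \<open>The local lift and the radial lift are interpolated by a bump function that is \<open>1\<close> near the origin and
  \<open>0\<close> outside a compact subset of the ball on which the local lift is controlled.\<close>

lemma foliation_lift_near_0:
  fixes X :: "'v::euclidean_space \<Rightarrow> 'v"
  assumes U: "open U" "0 \<in> U" and X: "X \<in> foliation k U"
  shows "X \<in> anchor_on U ` sections U (sym_multilinear k)"
proof -
  have smooth: "smooth_on U X" and ext: "X \<in> extensional U"
    using X by (auto simp: foliation_def smooth_maps_def)
  from X[unfolded foliation_def mem_Collect_eq, THEN conjunct2, THEN bspec, OF U(2)]
  obtain W and m :: nat and f :: "nat \<Rightarrow> nat \<Rightarrow> 'v \<Rightarrow> real" and Y :: "nat \<Rightarrow> 'v \<Rightarrow> 'v" where W: "open W" "0 \<in> W" "W \<subseteq> U"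
    and fY: "\<forall>j<m. (\<forall>i<k. f j i \<in> ideal0 W) \<and> Y j \<in> vector_fields W"
    and X_eq: "\<forall>x\<in>W. X x = (\<Sum>j<m. (\<Prod>i<k. f j i x) *\<^sub>R Y j x)"
    by (elim exE conjE) blast
  obtain e where e: "e > 0" "ball 0 e \<subseteq> W" using W open_contains_ball by blast
  have f: "smooth_on (ball 0 e) (f j i)" "f j i 0 = 0" if "j < m" "i < k" for j i
    using fY that W(2) smooth_on_subset[OF _ e(2)] by (auto simp: ideal0_def smooth_maps_def)
  have Y: "smooth_on (ball 0 e) (Y j)" if "j < m" for j
    using fY that smooth_on_subset[OF _ e(2)] by (auto simp: smooth_maps_def)
  obtain a1 where a1: "\<And>x. a1 x \<in> sym_multilinear k" "\<And>u. smooth_on (ball 0 e) (\<lambda>x. a1 x u)"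
    "\<And>x. x \<in> ball 0 e \<Longrightarrow> anchor x (a1 x) = (\<Sum>j<m. (\<Prod>i<k. f j i x) *\<^sub>R Y j x)"
    by (rule local_lift_at_0[OF f(1) f(2) Y]) blast+
  have a1_anchor: "anchor x (a1 x) = X x" if "x \<in> ball 0 e" for x
    using a1(3)[OF that] X_eq e(2) that by auto
  obtain \<psi> :: "'v \<Rightarrow> real" where psi: "smooth_on UNIV \<psi>" "\<And>x. norm x < e / 4 \<Longrightarrow> \<psi> x = 1"
    "\<And>x. norm x > 2 * (e / 4) \<Longrightarrow> \<psi> x = 0"
    by (rule smooth_bump[of "e / 4"]) (use e(1) in auto)
  \<comment> \<open>On the first region the section is the local lift, on the second one the radial lift, and on the third
    one both are smooth lifts.\<close>
  have regions: "norm x < e / 4 \<or> norm x > 2 * (e / 4) \<or> x \<in> ball 0 e \<and> x \<noteq> 0" for x :: 'v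
    using e(1) by (cases "x = 0") auto
  define a where "a x = \<psi> x *\<^sub>R a1 x + (1 - \<psi> x) *\<^sub>R radial_lift k X x" for x
  have a_in: "a x \<in> sym_multilinear k" for x
    unfolding a_def radial_lift_def
    by (intro subspace_add[OF subspace_sym_multilinear] subspace_scale[OF subspace_sym_multilinear]
        a1(1) sym_tensor_in)
  have a_anchor: "anchor x (a x) = X x" if "x \<in> U" for x
  proof -
    consider "norm x < e / 4" | "norm x > 2 * (e / 4)" | "x \<in> ball 0 e" "x \<noteq> 0"
      using regions[of x] by blast
    then show ?thesis
    proof cases
      case 1
      then have "a x = a1 x" using psi(2) by (simp add: a_def)
      then show ?thesis using a1_anchor 1 e(1) by simp
    next
      case 2
      then have "a x = radial_lift k X x" "x \<noteq> 0" using psi(3) e(1) by (auto simp: a_def)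
      then show ?thesis by (simp add: anchor_radial_lift)
    next
      case 3
      have "anchor x (a x) = \<psi> x *\<^sub>R anchor x (a1 x) + (1 - \<psi> x) *\<^sub>R anchor x (radial_lift k X x)"
        by (simp add: anchor_def a_def scaleR_fun_apply)
      then show ?thesis using a1_anchor[OF 3(1)] anchor_radial_lift[OF 3(2), of k X]
        by (simp add: algebra_simps)
    qed
  qed
  have a_smooth: "smooth_on U (\<lambda>x. a x u)" for u
  proof (rule smooth_on_locally)
    fix x assume x: "x \<in> U"
    consider "norm x < e / 4" | "norm x > 2 * (e / 4)" | "x \<in> ball 0 e" "x \<noteq> 0"
      using regions[of x] by blast
    then show "\<exists>W. open W \<and> x \<in> W \<and> smooth_on W (\<lambda>x. a x u)"
    proof cases
      case 1
      have "smooth_on (ball 0 (e / 4)) (\<lambda>x. a1 x u)"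
        by (rule smooth_on_subset[OF a1(2)]) (use e(1) in auto)
      then have "smooth_on (ball 0 (e / 4)) (\<lambda>x. a x u)"
        using smooth_on_cong[OF open_ball, of 0 "e / 4" "\<lambda>x. a x u" "\<lambda>x. a1 x u"] psi(2)
        by (simp add: a_def)
      then show ?thesis using 1 by (intro exI[of _ "ball 0 (e / 4)"]) simp
    next
      case 2
      let ?W = "U \<inter> - cball 0 (2 * (e / 4))"
      have W: "open ?W" using U(1) by (intro open_Int) auto
      have "0 \<notin> ?W" using e(1) by simp
      from smooth_on_radial_lift[OF W this smooth_on_subset[OF smooth]]
      have "smooth_on ?W (\<lambda>x. radial_lift k X x u)" by blast
      then have "smooth_on ?W (\<lambda>x. a x u)"
        using smooth_on_cong[OF W, of "\<lambda>x. a x u" "\<lambda>x. radial_lift k X x u"] psi(3)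
        by (simp add: a_def)
      then show ?thesis using 2 W x by (intro exI[of _ ?W]) simp
    next
      case 3
      let ?W = "U \<inter> ball 0 e - {0}"
      have W: "open ?W" using U(1) by (intro open_Diff open_Int) auto
      have lift: "smooth_on ?W (\<lambda>x. radial_lift k X x u)"
        by (rule smooth_on_radial_lift[OF W _ smooth_on_subset[OF smooth]]) auto
      have loc: "smooth_on ?W (\<lambda>x. a1 x u)" by (rule smooth_on_subset[OF a1(2)]) auto
      have bump: "smooth_on ?W \<psi>" by (rule smooth_on_subset[OF psi(1)]) simp
      have "smooth_on ?W (\<lambda>x. a x u)"
        unfolding a_def plus_fun_def scaleR_fun_apply
        by (intro smooth_on_add smooth_on_scaleR smooth_on_diff smooth_on_const W lift loc bump)
      then show ?thesis using 3 W x by (intro exI[of _ ?W]) simp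
    qed
  qed
  have "restrict a U \<in> sections U (sym_multilinear k)"
  proof (rule sections_symI[OF U(1)])
    show "smooth_on U (\<lambda>x. restrict a U x u)" for u
      using smooth_on_cong[OF U(1), of "\<lambda>x. restrict a U x u" "\<lambda>x. a x u"] a_smooth by simp
  qed (simp_all add: a_in)
  moreover have "X = anchor_on U (restrict a U)"
  proof (rule extensionalityI[OF ext])
    fix x assume "x \<in> U"
    then show "X x = anchor_on U (restrict a U) x" using a_anchor by (simp add: anchor_on_def)
  qed (simp add: anchor_on_def)
  ultimately show ?thesis by blast
qed

lemma anchor_image_eq_foliation:
  fixes U :: "'v::euclidean_space set"
  assumes "open U"
  shows "anchor_on U ` sections U (sym_multilinear k) = foliation k U"
proof (intro equalityI subsetI)
  fix X assume X: "X \<in> foliation k U"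
  show "X \<in> anchor_on U ` sections U (sym_multilinear k)"
  proof (cases "0 \<in> U")
    case True
    then show ?thesis by (rule foliation_lift_near_0[OF assms _ X])
  next
    case False
    moreover have "X \<in> vector_fields U" using X by (simp add: foliation_def)
    ultimately show ?thesis by (rule foliation_lift_away_from_0[OF assms])
  qed
qed (use anchor_section_in_foliation[OF assms] in blast)

theorem corollary2p7:
  fixes k :: nat
  assumes "k \<ge> 1"
  defines "E \<equiv> (sym_multilinear k :: ((nat \<Rightarrow> real ^ 'n) \<Rightarrow> real ^ 'n) set)"
  shows "trivial_lie_algebroid E anchor (bracket k) \<and>
    dim E = CARD('n) * ((CARD('n) + k - 1) choose k) \<and>
    (\<forall>U :: (real ^ 'n) set. open U \<longrightarrow> anchor_on U ` sections U E = foliation k U)"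
proof (intro conjI allI impI)
  show "trivial_lie_algebroid E anchor (bracket k)"
    unfolding E_def by (rule trivial_lie_algebroid_sym_multilinear[OF assms(1)])
  obtain B where "independent B" "span B = E" "card B = CARD('n) * ((CARD('n) + k - 1) choose k)"
    using sym_multilinear_basis[where 'v = "real ^ 'n" and k = k] by (auto simp: E_def)
  then show "dim E = CARD('n) * ((CARD('n) + k - 1) choose k)"
    using dim_span_eq_card_independent[of B] by simp
  show "anchor_on U ` sections U E = foliation k U" if "open U" for U :: "(real ^ 'n) set"
    unfolding E_def by (rule anchor_image_eq_foliation[OF that])
qed

end
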